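(* Let $f$ satisfy the $(2r,4r)$-restricted strong convexity and smoothness properties with parameter $\delta\in[0,1)$, and let $0\le\mu\le 1/3$. Write $N:=\|(\nabla f(\mathbf{X}^* ))_{\max(r)}\|_F$ and $\mathcal{R}_1:=\{\mathbf{Y}\in\mathbb{R}^{p\times r}_*: d([\mathbf{Y}],[\mathbf{Y}^*])\le\mu\,\sigma_r(\mathbf{Y}^* )/\kappa^*\}$. Then for every $\mathbf{Y}\in\mathcal{R}_1$, $$\lambda_{\min}(\overline{\mathrm{Hess}\,h([\mathbf{Y}])})\ge\Big(2(1-\mu/\kappa^* )^2-\tfrac{14}{3}\mu\Big)\sigma_r^2(\mathbf{Y}^* )-\Big(4\delta\big(\sigma_1(\mathbf{Y}^* )+\mu\sigma_r(\mathbf{Y}^* )/\kappa^*\big)^2+\tfrac{14}{3}\delta\mu\,\sigma_r^2(\mathbf{Y}^* )+2N\Big),$$ $$\lambda_{\max}(\overline{\mathrm{Hess}\,h([\mathbf{Y}])})\le 4\big(\sigma_1(\mathbf{Y}^* )+\mu\sigma_r(\mathbf{Y}^* )/\kappa^*\big)^2+\tfrac{14}{3}\mu\,\sigma_r^2(\mathbf{Y}^* )+\Big(4\delta\big(\sigma_1(\mathbf{Y}^* )+\mu\sigma_r(\mathbf{Y}^* )/\kappa^*\big)^2+\tfrac{14}{3}\delta\mu\,\sigma_r^2(\mathbf{Y}^* )+2N\Big).$$ In particular, suppose in addition that $(1-\mu/\kappa^* )^2-7\mu/3>0$ (for example $\mu<\frac{13-\sqrt{133}}{6}$) and that $$\delta\le\frac{(1-\mu/\kappa^*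 )^2-7\mu/3}{4\big(2(\kappa^*+\mu/\kappa^* )^2+7\mu/3\big)}\quad\text{and}\quad N\le\big((1-\mu/\kappa^* )^2-7\mu/3\big)\sigma_r^2(\mathbf{Y}^* )/4 .$$ Then for every $\mathbf{Y}\in\mathcal{R}_1$, $$\lambda_{\min}(\overline{\mathrm{Hess}\,h([\mathbf{Y}])})\ge\big((1-\mu/\kappa^* )^2-7\mu/3\big)\sigma_r^2(\mathbf{Y}^* )>0,$$ so $h$ is geodesically strongly convex and smooth in $\mathcal{R}_1$. Moreover, under these conditions, if there is a Riemannian first-order stationary point $[\widehat{\mathbf{Y}}]$ of $h$ in $\mathcal{R}_1$, then it is the unique local minimizer of $h$ in $\mathcal{R}_1$, and $$d([\widehat{\mathbf{Y}}],[\mathbf{Y}^*])\le\frac{2\,\|\nabla f(\mathbf{Y}^*\mathbf{Y}^{*\top})\mathbf{Y}^*\|_F}{\big((1-\mu/\kappa^* )^2-7\mu/3\big)\sigma_r^2(\mathbf{Y}^* )}\le\frac{2\,\|\mathbf{Y}^*\|\,N}{\big((1-\mu/\kappa^* )^2-7\mu/3\big)\sigma_r^2(\mathbf{Y}^* )} .$$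
   Context: Let $0<r\le p$ be integers. $\|\cdot\|$ and $\|\cdot\|_F$ are the spectral and Frobenius norms, $\sigma_i(\cdot)$ is the $i$-th largest singular value, and $\mathbf{A}_{\max(r)}$ is the best rank-$r$ approximation of $\mathbf{A}$ in Frobenius norm (truncated SVD). $\mathbb{R}^{p\times r}_*$ is the set of real $p\times r$ matrices of full column rank and $\mathbb{O}_r$ is the orthogonal group. Quotient geometry: $\mathcal{M}:=\mathbb{R}^{p\times r}_*/\mathbb{O}_r$ has points $[\mathbf{Y}]=\{\mathbf{Y}\mathbf{O}:\mathbf{O}\in\mathbb{O}_r\}$ and carries the Riemannian metric induced from $\bar g_{\mathbf{Y}}(\eta,\theta)=\mathrm{tr}(\eta^\top\theta)$; tangent vectors at $[\mathbf{Y}]$ are represented by horizontal lifts in $\mathcal{H}_{\mathbf{Y}}=\{\theta\in\mathbb{R}^{p\times r}:\mathbf{Y}^\top\theta\text{ symmetric}\}$. The geodesic distance is $d([\mathbf{Y}_1],[\mathbf{Y}_2])=\min_{\mathbf{Q}\in\mathbb{O}_r}\|\mathbf{Y}_2\mathbf{Q}-\mathbf{Y}_1\|_F$. Objective: $f:\mathbb{R}^{p\times p}\to\mathbb{R}$ is twice continuously differentiable with $f(\mathbf{X})=f(\mathbf{X}^\top)$, with Euclidean gradient $\nabla f$ and Hessian bilinear form $\nabla^2f(\mathbf{X})[\cdot,\cdot]$. $f$ satisfies the $(2r,4r)$-restricted strong convexity and smoothness properties with parameter $0\le\delta<1$ if $(1-\delta)\|\mathbf{G}\|_F^2\le\nabla^2f(\mathbf{X})[\mathbf{G},\mathbf{G}]\le(1+\delta)\|\mathbf{G}\|_F^2$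 for all $\mathbf{X},\mathbf{G}\in\mathbb{R}^{p\times p}$ with $\mathrm{rank}(\mathbf{X})\le2r$, $\mathrm{rank}(\mathbf{G})\le4r$. Define $h:\mathcal{M}\to\mathbb{R}$ by $h([\mathbf{Y}])=f(\mathbf{Y}\mathbf{Y}^\top)$. The horizontal lifts of its Riemannian gradient and Hessian are $\overline{\mathrm{grad}\,h([\mathbf{Y}])}=2\nabla f(\mathbf{Y}\mathbf{Y}^\top)\mathbf{Y}$ and $\overline{\mathrm{Hess}\,h([\mathbf{Y}])}[\theta,\theta]=\nabla^2f(\mathbf{Y}\mathbf{Y}^\top)[\mathbf{Y}\theta^\top+\theta\mathbf{Y}^\top,\mathbf{Y}\theta^\top+\theta\mathbf{Y}^\top]+2\langle\nabla f(\mathbf{Y}\mathbf{Y}^\top),\theta\theta^\top\rangle$ for $\theta\in\mathcal{H}_{\mathbf{Y}}$. $\lambda_{\min},\lambda_{\max}$ of the Hessian are the minimum and maximum of this quadratic form over $\theta\in\mathcal{H}_{\mathbf{Y}}$ with $\|\theta\|_F=1$. A Riemannian first-order stationary point is a point where the Riemannian gradient vanishes. Target: $\mathbf{X}^*\in\mathbb{R}^{p\times p}$ is a fixed symmetric positive semidefinite matrix of rank $r$ with reduced eigendecomposition $\mathbf{U}^*\boldsymbol{\Sigma}^*\mathbf{U}^{*\top}$; $\mathbf{Y}^*=\mathbf{U}^*\boldsymbol{\Sigma}^{*1/2}$, and $\kappa^*=\sigma_1(\mathbf{Y}^* )/\sigma_r(\mathbf{Y}^* )$. Convexity: a set in $\mathcal{M}$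 is geodesically convex if any two of its points can be joined by a geodesic contained in it; a function is geodesically strongly convex on a set if the set is geodesically convex and the Riemannian Hessian is bounded below there by a positive multiple of the identity; it is smooth there if the Riemannian Hessian is bounded above there by a constant multiple of the identity. The ($\mathbb{O}_r$-invariant) set $\mathcal{R}_1$ is identified with its image in $\mathcal{M}$. *)

theory Defs
  imports "HOL-Analysis.Analysis" "HOL-Computational_Algebra.Polynomial"
begin

section \<open>Matrices\<close>

text \<open>
  On matrices of type \<open>real^'n^'m\<close>, the library's \<open>norm\<close> is the Frobenius norm and the library's
  inner product is \<open>tr(A\<^sup>T B)\<close>.
\<close>

definition spectral_norm :: "real^'n^'m \<Rightarrow> real" where
  "spectral_norm A = onorm ((*v) A)"

definition diag_mat :: "real^'n \<Rightarrow> real^'n^'n" where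
  "diag_mat s = (\<chi> i j. if i = j then s $ i else 0)"

definition charpoly :: "real^'n^'n \<Rightarrow> real poly" where
  "charpoly A = det (\<chi> i j. (if i = j then [:0, 1:] else 0) - [:A $ i $ j:])"

text \<open>
  Eigenvalues of \<open>A\<^sup>T A\<close> are listed with multiplicity and in decreasing order; singular values are
  indexed from 1. If \<open>A\<close> has more columns than rows, the list is padded with zeros.
\<close>

definition singular_values :: "real^'n^'m \<Rightarrow> real list" where
  "singular_values A =
     map sqrt (rev (sorted_list_of_multiset (proots (charpoly (transpose A ** A)))))"

definition sing_val :: "nat \<Rightarrow> real^'n^'m \<Rightarrow> real" where
  "sing_val i A = singular_values A ! (i - 1)"

definition cond_num :: "real^'r^'p \<Rightarrow> real" where
  "cond_num Y = sing_val 1 Y / sing_val CARD('r) Y"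

definition pos_semidef :: "real^'n^'n \<Rightarrow> bool" where
  "pos_semidef A \<longleftrightarrow> transpose A = A \<and> (\<forall>x. 0 \<le> x \<bullet> (A *v x))"

definition reduced_eigendecomp :: "real^'p^'p \<Rightarrow> real^'r^'p \<Rightarrow> real^'r \<Rightarrow> bool" where
  "reduced_eigendecomp X U s \<longleftrightarrow>
     transpose U ** U = mat 1 \<and> (\<forall>i. s $ i \<noteq> 0) \<and> X = U ** diag_mat s ** transpose U"

text \<open>
  A best approximation need not be unique when singular values are repeated, hence a predicate
  rather than a function.
\<close>

definition best_rank_approx :: "nat \<Rightarrow> real^'n^'m \<Rightarrow> real^'n^'m \<Rightarrow> bool" where
  "best_rank_approx k A B \<longleftrightarrow>
     rank B \<le> k \<and> (\<forall>C. rank C \<le> k \<longrightarrow> norm (A - B) \<le> norm (A - C))"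


section \<open>Euclidean gradient and Hessian\<close>

definition egrad :: "('a::real_inner \<Rightarrow> real) \<Rightarrow> 'a \<Rightarrow> 'a" where
  "egrad f x = (THE g. GDERIV f x :> g)"

definition ehess :: "('a::real_inner \<Rightarrow> real) \<Rightarrow> 'a \<Rightarrow> 'a \<Rightarrow> 'a \<Rightarrow> real" where
  "ehess f x u v = frechet_derivative (egrad f) (at x) u \<bullet> v"

definition twice_cont_diff :: "('a::euclidean_space \<Rightarrow> real) \<Rightarrow> bool" where
  "twice_cont_diff f \<longleftrightarrow>
     (\<forall>x. f differentiable (at x)) \<and> (\<forall>x. egrad f differentiable (at x)) \<and>
     (\<forall>u v. continuous_on UNIV (\<lambda>x. ehess f x u v))"

definition restricted_convex_smooth :: "nat \<Rightarrow> nat \<Rightarrow> real \<Rightarrow> (real^'p^'p \<Rightarrow> real) \<Rightarrow> bool" where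
  "restricted_convex_smooth a b \<delta> f \<longleftrightarrow>
     (\<forall>X G. rank X \<le> a \<and> rank G \<le> b \<longrightarrow>
        (1 - \<delta>) * (norm G)\<^sup>2 \<le> ehess f X G G \<and> ehess f X G G \<le> (1 + \<delta>) * (norm G)\<^sup>2)"


section \<open>The quotient of the full-rank matrices by the orthogonal group\<close>

definition full_rank :: "(real^'r^'p) set" where
  "full_rank = {Y. rank Y = CARD('r)}"

definition cls :: "real^'r^'p \<Rightarrow> (real^'r^'p) set" where
  "cls Y = {Y ** Q |Q. orthogonal_matrix Q}"

definition quot_mfd :: "(real^'r^'p) set set" where
  "quot_mfd = cls ` full_rank"

definition qdist :: "real^'r^'p \<Rightarrow> real^'r^'p \<Rightarrow> real" where
  "qdist Y1 Y2 = (INF Q\<in>{Q. orthogonal_matrix Q}. norm (Y2 ** Q - Y1))"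

definition horizontal :: "real^'r^'p \<Rightarrow> (real^'r^'p) set" where
  "horizontal Y = {\<theta>. transpose (transpose Y ** \<theta>) = transpose Y ** \<theta>}"

definition hproj :: "real^'r^'p \<Rightarrow> real^'r^'p \<Rightarrow> real^'r^'p" where
  "hproj Y = closest_point (horizontal Y)"

text \<open>
  Functions on the quotient take equivalence classes as arguments. The total space is open in
  a Euclidean space, so the lift of the Riemannian gradient is the Euclidean gradient of the
  lifted function (which is horizontal, by invariance), and the Levi-Civita connection of the
  quotient lifts to the horizontal projection of the flat one. This gives the Riemannian Hessian
  below; the lemmas \<open>grad_lift_quot_fun\<close> and \<open>hess_form_quot_fun\<close> at the end of the theory derive
  the closed formulas for \<open>h([Y]) = f(Y Y\<^sup>T)\<close>.
\<close>

definition grad_lift :: "((real^'r^'p) set \<Rightarrow> real) \<Rightarrow> real^'r^'p \<Rightarrow> real^'r^'p" where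
  "grad_lift h = egrad (\<lambda>Y. h (cls Y))"

definition hess_lift :: "((real^'r^'p) set \<Rightarrow> real) \<Rightarrow> real^'r^'p \<Rightarrow> real^'r^'p \<Rightarrow> real^'r^'p" where
  "hess_lift h Y \<theta> = hproj Y (frechet_derivative (grad_lift h) (at Y) \<theta>)"

definition hess_form :: "((real^'r^'p) set \<Rightarrow> real) \<Rightarrow> real^'r^'p \<Rightarrow> real^'r^'p \<Rightarrow> real" where
  "hess_form h Y \<theta> = hess_lift h Y \<theta> \<bullet> \<theta>"

text \<open>
  The unit sphere of the horizontal space is compact and nonempty (if \<open>Y \<noteq> 0\<close>), so the infimum
  and supremum are attained.
\<close>

definition hess_lmin :: "((real^'r^'p) set \<Rightarrow> real) \<Rightarrow> real^'r^'p \<Rightarrow> real" where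
  "hess_lmin h Y = (INF \<theta>\<in>{\<theta> \<in> horizontal Y. norm \<theta> = 1}. hess_form h Y \<theta>)"

definition hess_lmax :: "((real^'r^'p) set \<Rightarrow> real) \<Rightarrow> real^'r^'p \<Rightarrow> real" where
  "hess_lmax h Y = (SUP \<theta>\<in>{\<theta> \<in> horizontal Y. norm \<theta> = 1}. hess_form h Y \<theta>)"

text \<open>
  Geodesics have vanishing covariant acceleration, expressed here through a horizontal lift
  \<open>c\<close> with velocity \<open>v\<close> and Euclidean acceleration \<open>a\<close>.
\<close>

definition geodesic :: "(real \<Rightarrow> (real^'r^'p) set) \<Rightarrow> bool" where
  "geodesic \<gamma> \<longleftrightarrow>
     (\<exists>c v a. \<forall>t\<in>{0..1}.
        c t \<in> full_rank \<and> \<gamma> t = cls (c t) \<and>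
        (c has_vector_derivative v t) (at t within {0..1}) \<and> v t \<in> horizontal (c t) \<and>
        (v has_vector_derivative a t) (at t within {0..1}) \<and> hproj (c t) (a t) = 0)"

definition geod_convex :: "(real^'r^'p) set set \<Rightarrow> bool" where
  "geod_convex C \<longleftrightarrow> C \<subseteq> quot_mfd \<and>
     (\<forall>P\<in>C. \<forall>P'\<in>C. \<exists>\<gamma>. geodesic \<gamma> \<and> \<gamma> 0 = P \<and> \<gamma> 1 = P' \<and> \<gamma> ` {0..1} \<subseteq> C)"

definition geod_strongly_convex_on ::
    "(real^'r^'p) set set \<Rightarrow> ((real^'r^'p) set \<Rightarrow> real) \<Rightarrow> bool" where
  "geod_strongly_convex_on C h \<longleftrightarrow> geod_convex C \<and>
     (\<exists>m>0. \<forall>Y. cls Y \<in> C \<longrightarrow> (\<forall>\<theta>\<in>horizontal Y. m * (norm \<theta>)\<^sup>2 \<le> hess_form h Y \<theta>))"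

definition geod_smooth_on ::
    "(real^'r^'p) set set \<Rightarrow> ((real^'r^'p) set \<Rightarrow> real) \<Rightarrow> bool" where
  "geod_smooth_on C h \<longleftrightarrow>
     (\<exists>L. \<forall>Y. cls Y \<in> C \<longrightarrow> (\<forall>\<theta>\<in>horizontal Y. hess_form h Y \<theta> \<le> L * (norm \<theta>)\<^sup>2))"

text \<open>\<open>[Y]\<close> is a local minimizer of the restriction of \<open>h\<close> to \<open>C\<close>.\<close>

definition local_minimizer_on ::
    "(real^'r^'p) set set \<Rightarrow> ((real^'r^'p) set \<Rightarrow> real) \<Rightarrow> real^'r^'p \<Rightarrow> bool" where
  "local_minimizer_on C h Y \<longleftrightarrow> cls Y \<in> C \<and>
     (\<exists>\<epsilon>>0. \<forall>Z. cls Z \<in> C \<and> qdist Y Z < \<epsilon> \<longrightarrow> h (cls Y) \<le> h (cls Z))"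

definition quot_fun :: "(real^'p^'p \<Rightarrow> real) \<Rightarrow> (real^'r^'p) set \<Rightarrow> real" where
  "quot_fun f P = (THE v. \<forall>Y\<in>P. v = f (Y ** transpose Y))"

definition basin :: "real \<Rightarrow> real^'r^'p \<Rightarrow> (real^'r^'p) set" where
  "basin \<mu> Ys = {Y \<in> full_rank. qdist Y Ys \<le> \<mu> * sing_val CARD('r) Ys / cond_num Ys}"


section \<open>Closed formulas for the lifted gradient and Hessian\<close>

lemma quot_fun_cls: "quot_fun f (cls Y) = f (Y ** transpose Y)"
proof -
  have *: "(Y ** Q) ** transpose (Y ** Q) = Y ** transpose Y" if "orthogonal_matrix Q" for Q :: "real^'b^'b"
    using that unfolding orthogonal_matrix_def
    by (metis matrix_mul_assoc matrix_mul_rid matrix_transpose_mul)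
  have "Y \<in> cls Y"
    unfolding cls_def by (auto intro!: exI[of _ "mat 1"] simp: orthogonal_matrix_id)
  then show ?thesis
    unfolding quot_fun_def using *
    by (intro the_equality) (auto simp: cls_def)
qed

lemma inner_mat: "(A::real^'n^'m) \<bullet> B = (\<Sum>i\<in>UNIV. \<Sum>j\<in>UNIV. A $ i $ j * B $ i $ j)"
  by (simp add: inner_vec_def)

lemma inner_transpose: "transpose A \<bullet> transpose B = A \<bullet> (B::real^'n^'m)"
  unfolding inner_mat transpose_def by (subst sum.swap) simp

lemma inner_mult_left: "((A::real^'k^'m) ** (B::real^'n^'k)) \<bullet> C = A \<bullet> (C ** transpose B)"
  unfolding inner_mat matrix_matrix_mult_def transpose_def
  by (simp add: sum_distrib_left sum_distrib_right, subst (2) sum.swap, simp add: ac_simps)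

lemma bounded_bilinear_matrix_mult:
  "bounded_bilinear ((**) :: real^'k^'m \<Rightarrow> real^'n^'k \<Rightarrow> real^'n^'m)"
  unfolding bilinear_conv_bounded_bilinear[symmetric] bilinear_def
  by (auto intro!: linearI simp: matrix_matrix_mult_def vec_eq_iff sum.distrib sum_distrib_left
      algebra_simps)

lemma bounded_linear_transpose: "bounded_linear (transpose :: real^'n^'m \<Rightarrow> real^'m^'n)"
  unfolding linear_conv_bounded_linear[symmetric]
  by (auto intro!: linearI simp: transpose_def vec_eq_iff)

lemma egradI: "GDERIV f x :> g \<Longrightarrow> egrad f x = g"
  unfolding egrad_def
proof (rule the_equality, assumption)
  fix g' assume "GDERIV f x :> g" "GDERIV f x :> g'"
  then have "(\<lambda>h. h \<bullet> g) = (\<lambda>h. h \<bullet> g')"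
    unfolding gderiv_def by (rule has_derivative_unique)
  then show "g' = g" by (metis inner_commute vector_eq_ldot)
qed

lemma egrad_works:
  fixes f :: "'a::euclidean_space \<Rightarrow> real"
  assumes "f differentiable (at x)"
  shows "GDERIV f x :> egrad f x"
proof -
  obtain D where D: "(f has_derivative D) (at x)" using assms by (auto simp: differentiable_def)
  then have lin: "linear D" by (rule has_derivative_linear)
  have "GDERIV f x :> adjoint D 1"
    unfolding gderiv_def using D adjoint_works[OF lin, of _ 1] by (simp add: inner_commute)
  then show ?thesis using egradI by metis
qed

lemma has_derivative_gram:
  "((\<lambda>Y::real^'r^'p. Y ** transpose Y) has_derivative (\<lambda>\<theta>. Y ** transpose \<theta> + \<theta> ** transpose Y)) (at Y)"
  by (rule bounded_bilinear.FDERIV[OF bounded_bilinear_matrix_mult has_derivative_ident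
        bounded_linear.has_derivative[OF bounded_linear_transpose has_derivative_ident]])

lemma egrad_transpose:
  fixes f :: "real^'p^'p \<Rightarrow> real"
  assumes d: "\<And>x. f differentiable (at x)" and sym: "\<And>X. f X = f (transpose X)"
  shows "egrad f (transpose X) = transpose (egrad f X)"
proof (rule egradI)
  have "((\<lambda>X. f (transpose X)) has_derivative (\<lambda>h. transpose h \<bullet> egrad f X)) (at (transpose X))"
    by (rule has_derivative_compose[OF bounded_linear.has_derivative[OF bounded_linear_transpose
            has_derivative_ident]])
       (use egrad_works[OF d] in \<open>simp add: gderiv_def\<close>)
  then show "GDERIV f (transpose X) :> transpose (egrad f X)"
    unfolding gderiv_def using sym inner_transpose
    by (metis (no_types, lifting) ext transpose_transpose)
qed

lemma gram_symmetric: "transpose (Y ** transpose Y) = Y ** transpose (Y::real^'r^'p)"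
  by (simp add: matrix_transpose_mul)

lemma grad_lift_quot_fun:
  fixes f :: "real^'p^'p \<Rightarrow> real" and Y :: "real^'r^'p"
  assumes d: "\<And>x. f differentiable (at x)" and sym: "\<And>X. f X = f (transpose X)"
  shows "grad_lift (quot_fun f) Y = 2 *\<^sub>R (egrad f (Y ** transpose Y) ** Y)"
  unfolding grad_lift_def quot_fun_cls
proof (rule egradI)
  let ?G = "egrad f (Y ** transpose Y)"
  have symG: "transpose ?G = ?G"
    using egrad_transpose[OF d sym] by (metis gram_symmetric)
  have "((\<lambda>Y. f (Y ** transpose Y)) has_derivative
      (\<lambda>\<theta>. (Y ** transpose \<theta> + \<theta> ** transpose Y) \<bullet> ?G)) (at Y)"
    by (rule has_derivative_compose[OF has_derivative_gram])
       (use egrad_works[OF d] in \<open>simp add: gderiv_def\<close>)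
  moreover have "(Y ** transpose \<theta> + \<theta> ** transpose Y) \<bullet> ?G = \<theta> \<bullet> (2 *\<^sub>R (?G ** Y))" for \<theta>
  proof -
    have "(Y ** transpose \<theta>) \<bullet> ?G = (\<theta> ** transpose Y) \<bullet> ?G"
      using inner_transpose[of "Y ** transpose \<theta>" ?G] symG by (simp add: matrix_transpose_mul)
    then show ?thesis by (simp add: inner_add_left inner_mult_left)
  qed
  ultimately show "GDERIV (\<lambda>Y. f (Y ** transpose Y)) Y :> 2 *\<^sub>R (?G ** Y)"
    unfolding gderiv_def by simp
qed

lemma subspace_horizontal: "subspace (horizontal Y)"
  unfolding subspace_def horizontal_def
  by (auto simp: transpose_def matrix_matrix_mult_def vec_eq_iff distrib_left sum.distrib
      sum_distrib_left[symmetric] mult.left_commute)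

lemma inner_hproj:
  assumes "\<theta> \<in> horizontal Y"
  shows "hproj Y A \<bullet> \<theta> = A \<bullet> \<theta>"
proof -
  note sub = subspace_horizontal[of Y]
  have cl: "closed (horizontal Y)" and cv: "convex (horizontal Y)"
    using sub by (simp_all add: closed_subspace subspace_imp_convex)
  have P: "hproj Y A \<in> horizontal Y"
    unfolding hproj_def using closest_point_in_set[OF cl] assms by blast
  have *: "(A - hproj Y A) \<bullet> (z - hproj Y A) \<le> 0" if "z \<in> horizontal Y" for z
    unfolding hproj_def by (rule closest_point_dot[OF cv cl that])
  have "(A - hproj Y A) \<bullet> \<theta> \<le> 0"
    using *[OF subspace_add[OF sub P assms]] by simp
  moreover have "(A - hproj Y A) \<bullet> (- \<theta>) \<le> 0"
    using *[OF subspace_add[OF sub P subspace_neg[OF sub assms]]] by simp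
  ultimately show ?thesis by (simp add: inner_diff_left)
qed

lemma hess_form_quot_fun:
  fixes f :: "real^'p^'p \<Rightarrow> real" and Y :: "real^'r^'p"
  assumes C2: "twice_cont_diff f" and sym: "\<And>X. f X = f (transpose X)"
    and hor: "\<theta> \<in> horizontal Y"
  shows "hess_form (quot_fun f) Y \<theta> =
     ehess f (Y ** transpose Y) (Y ** transpose \<theta> + \<theta> ** transpose Y)
       (Y ** transpose \<theta> + \<theta> ** transpose Y)
     + 2 * (egrad f (Y ** transpose Y) \<bullet> (\<theta> ** transpose \<theta>))"
proof -
  have d: "\<And>x. f differentiable (at x)" and d2: "\<And>x. egrad f differentiable (at x)"
    using C2 by (auto simp: twice_cont_diff_def)
  let ?X = "Y ** transpose Y" and ?S = "Y ** transpose \<theta> + \<theta> ** transpose Y"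
  define D where "D = frechet_derivative (egrad f) (at ?X)"
  have D: "(egrad f has_derivative D) (at ?X)"
    unfolding D_def using d2 frechet_derivative_works by blast
  have DT: "D (transpose H) = transpose (D H)" for H
  proof -
    have "((\<lambda>X. egrad f (transpose X)) has_derivative (\<lambda>H. D (transpose H))) (at ?X)"
      by (rule has_derivative_compose[OF bounded_linear.has_derivative[OF bounded_linear_transpose
              has_derivative_ident]]) (simp add: gram_symmetric D)
    moreover have "((\<lambda>X. egrad f (transpose X)) has_derivative (\<lambda>H. transpose (D H))) (at ?X)"
      unfolding egrad_transpose[OF d sym]
      by (rule bounded_linear.has_derivative[OF bounded_linear_transpose D])
    ultimately show ?thesis using has_derivative_unique by metis
  qed
  have grad: "grad_lift (quot_fun f) = (\<lambda>Y. 2 *\<^sub>R (egrad f (Y ** transpose Y) ** Y))"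
    using grad_lift_quot_fun[OF d sym] by auto
  have "((\<lambda>Y. egrad f (Y ** transpose Y)) has_derivative
      (\<lambda>\<theta>. D (Y ** transpose \<theta> + \<theta> ** transpose Y))) (at Y)"
    by (rule has_derivative_compose[OF has_derivative_gram D])
  from bounded_bilinear.FDERIV[OF bounded_bilinear_matrix_mult this has_derivative_ident]
  have "(grad_lift (quot_fun f) has_derivative
      (\<lambda>\<theta>. 2 *\<^sub>R (egrad f ?X ** \<theta> + D (Y ** transpose \<theta> + \<theta> ** transpose Y) ** Y))) (at Y)"
    unfolding grad by (rule has_derivative_scaleR_right)
  from frechet_derivative_at[OF this, symmetric]
  have "frechet_derivative (grad_lift (quot_fun f)) (at Y) \<theta> =
      2 *\<^sub>R (egrad f ?X ** \<theta> + D ?S ** Y)"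
    by simp
  then have eq: "hess_form (quot_fun f) Y \<theta> = 2 * ((egrad f ?X ** \<theta>) \<bullet> \<theta>) + 2 * ((D ?S ** Y) \<bullet> \<theta>)"
    unfolding hess_form_def hess_lift_def using inner_hproj[OF hor] by (simp add: inner_add_left)
  have "transpose ?S = ?S"
  proof -
    have "transpose (A + B) = transpose A + transpose B" for A B :: "real^'p^'p"
      by (simp add: transpose_def vec_eq_iff)
    then show ?thesis by (simp add: matrix_transpose_mul add.commute)
  qed
  then have "transpose (D ?S) = D ?S" using DT by metis
  then have "D ?S \<bullet> (Y ** transpose \<theta>) = D ?S \<bullet> (\<theta> ** transpose Y)"
    using inner_transpose[of "D ?S" "Y ** transpose \<theta>"] by (simp add: matrix_transpose_mul)
  then have "D ?S \<bullet> ?S = 2 * ((D ?S ** Y) \<bullet> \<theta>)"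
    by (simp add: inner_add_right inner_mult_left)
  then show ?thesis using eq by (simp add: ehess_def D_def inner_mult_left)
qed

end

theory Submission
  imports Defs
begin

text \<open>
  Every horizontal tangent vector gives a straight line that projects to a geodesic, so convexity of
  the ball around \<open>[Ys]\<close> reduces to aligned segments. On such a segment the squared distance to \<open>[Ys]\<close>
  cannot have an interior maximum: at a point aligned with \<open>Ys\<close> it is bounded below by a parabola of
  positive curvature, because only the skew part of \<open>Ys\<^sup>T c\<close> can be compensated by a rotation.

  The Hessian bound splits \<open>\<nabla>f(YY\<^sup>T)\<close> into its value at \<open>X\<^sup>*\<close>, controlled by the best rank-\<open>r\<close>
  approximation, and an increment controlled by polarising the restricted convexity condition.
  The claims on stationary points follow from the monotonicity of the derivative of \<open>h\<close> along aligned lines.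
\<close>

section \<open>Frobenius norms, ranks and orthogonal factors\<close>

text \<open>The obstacle to convexity is that \<open>qdist\<close> is a minimum over rotations, and
  a minimum of convex functions need not be convex: along a horizontal line the optimal rotation
  moves too. Its effect is of second order, so constants decide whether it beats the curvature of
  the Frobenius distance. The radius \<open>\<mu> * \<sigma>r / \<kappa>\<close> contains
  \<open>\<kappa>\<close> so that its product with the largest singular value is
  \<open>\<mu> * \<sigma>r\<^sup>2\<close>; even at twice this radius,
  \<open>\<mu> \<le> 1/3\<close> keeps the eigenvalues of \<open>Z\<^sup>T c\<close>, for
  \<open>c\<close> aligned with \<open>Z\<close>, at or above a third of \<open>b\<^sup>2\<close>.
  With slack for a short step, the loss is at most 16/21 of the squared step. This is below 1 thanks
  to the factor 2 in \<open>norm_skew_mult_le\<close>; the triangle inequality alone would give 4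
  there, hence 32/21 and no conclusion. Beyond their order and positivity, the singular values of
  \<open>Ys\<close> enter only through the inequalities
  \<open>b * norm x \<le> norm (Z *v x)\<close> and \<open>norm (Z *v x) \<le> a * norm x\<close>,
  which survive rotations and small perturbations.\<close>

lemmas matrix_mult_add_left = bounded_bilinear.add_left[OF bounded_bilinear_matrix_mult]
  and matrix_mult_add_right = bounded_bilinear.add_right[OF bounded_bilinear_matrix_mult]
  and matrix_mult_diff_left = bounded_bilinear.diff_left[OF bounded_bilinear_matrix_mult]
  and matrix_mult_diff_right = bounded_bilinear.diff_right[OF bounded_bilinear_matrix_mult]
  and matrix_mult_scaleR_left = bounded_bilinear.scaleR_left[OF bounded_bilinear_matrix_mult]
  and matrix_mult_scaleR_right = bounded_bilinear.scaleR_right[OF bounded_bilinear_matrix_mult]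
  and transpose_add = linear_add[OF bounded_linear.linear[OF bounded_linear_transpose]]
  and transpose_diff = linear_diff[OF bounded_linear.linear[OF bounded_linear_transpose]]
  and transpose_scaleR = linear_cmul[OF bounded_linear.linear[OF bounded_linear_transpose]]

lemmas matrix_linear_simps = matrix_mult_add_left matrix_mult_add_right matrix_mult_diff_left
  matrix_mult_diff_right matrix_mult_scaleR_left matrix_mult_scaleR_right
  transpose_add transpose_diff transpose_scaleR

lemma norm_transpose: "norm (transpose A) = norm (A :: real^'n^'m)"
  by (simp add: norm_eq_sqrt_inner inner_transpose)

lemma inner_mult_right: "((A::real^'k^'m) ** (B::real^'n^'k)) \<bullet> C = B \<bullet> (transpose A ** C)"
proof -
  have "(A ** B) \<bullet> C = (transpose B ** transpose A) \<bullet> transpose C"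
    by (metis inner_transpose matrix_transpose_mul)
  also have "\<dots> = transpose B \<bullet> transpose (transpose A ** C)"
    by (simp add: inner_mult_left matrix_transpose_mul)
  finally show ?thesis by (simp add: inner_transpose)
qed

lemma inner_columns: "(A::real^'n^'m) \<bullet> B = (\<Sum>j\<in>UNIV. column j A \<bullet> column j B)"
  unfolding inner_mat by (subst sum.swap) (simp add: inner_vec_def column_def)

lemma norm_columns: "(norm (A::real^'n^'m))\<^sup>2 = (\<Sum>j\<in>UNIV. (norm (column j A))\<^sup>2)"
  unfolding power2_norm_eq_inner by (rule inner_columns)

lemma column_matrix_mult: "column j ((A::real^'k^'m) ** (B::real^'n^'k)) = A *v column j B"
  by (simp add: column_def matrix_matrix_mult_def matrix_vector_mult_def vec_eq_iff)

lemma norm_matrix_vector_mult_le: "norm ((A::real^'n^'m) *v x) \<le> norm A * norm x"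
proof -
  have "(norm (A *v x))\<^sup>2 = (\<Sum>i\<in>UNIV. (A $ i \<bullet> x)\<^sup>2)"
    unfolding power2_norm_eq_inner
    by (subst inner_vec_def) (simp add: matrix_mult_dot power2_eq_square)
  also have "\<dots> \<le> (\<Sum>i\<in>UNIV. (norm (A $ i))\<^sup>2 * (norm x)\<^sup>2)"
    by (intro sum_mono) (simp add: Cauchy_Schwarz_ineq power2_norm_eq_inner)
  also have "\<dots> = (norm A * norm x)\<^sup>2"
    by (simp add: power_mult_distrib power2_norm_eq_inner inner_vec_def[of A] sum_distrib_right)
  finally show ?thesis by (rule power2_le_imp_le) simp
qed

text \<open>\<open>A\<close> acts on each column of \<open>B\<close> separately and the squared
  Frobenius norm is the sum over columns. This lets singular value bounds, stated for vectors, act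
  on matrix products.\<close>

lemma norm_matrix_mult_le_op:
  fixes A :: "real^'k^'m" and B :: "real^'n^'k"
  assumes "\<And>x. norm (A *v x) \<le> c * norm x" and "0 \<le> c"
  shows "norm (A ** B) \<le> c * norm B"
proof (rule power2_le_imp_le)
  have "(norm (A ** B))\<^sup>2 \<le> (\<Sum>j\<in>UNIV. (c * norm (column j B))\<^sup>2)"
    unfolding norm_columns column_matrix_mult by (intro sum_mono power_mono assms) simp
  then show "(norm (A ** B))\<^sup>2 \<le> (c * norm B)\<^sup>2"
    by (simp add: power_mult_distrib sum_distrib_left norm_columns[of B])
qed (simp add: assms)

lemma norm_matrix_mult_ge_op:
  fixes A :: "real^'k^'m" and B :: "real^'n^'k"
  assumes "\<And>x. c * norm x \<le> norm (A *v x)" and "0 \<le> c"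
  shows "c * norm B \<le> norm (A ** B)"
proof (rule power2_le_imp_le)
  have "(norm (A ** B))\<^sup>2 \<ge> (\<Sum>j\<in>UNIV. (c * norm (column j B))\<^sup>2)"
    unfolding norm_columns column_matrix_mult by (intro sum_mono power_mono assms) (simp add: assms)
  then show "(c * norm B)\<^sup>2 \<le> (norm (A ** B))\<^sup>2"
    by (simp add: power_mult_distrib sum_distrib_left norm_columns[of B])
qed simp

lemma norm_matrix_mult_le: "norm ((A::real^'k^'m) ** (B::real^'n^'k)) \<le> norm A * norm B"
  by (rule norm_matrix_mult_le_op) (simp_all add: norm_matrix_vector_mult_le)

lemma rank_add_le: "rank (A + B) \<le> rank A + rank (B :: real^'n^'m)"
proof -
  let ?R = "\<lambda>A::real^'n^'m. range (\<lambda>x. A *v x)"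
  have sub: "subspace (?R A)" for A :: "real^'n^'m"
    by (rule linear_subspace_image) auto
  have "?R (A + B) \<subseteq> {x + y |x y. x \<in> ?R A \<and> y \<in> ?R B}"
    by (auto simp: matrix_vector_mult_add_rdistrib)
  then have "dim (?R (A + B)) \<le> dim {x + y |x y. x \<in> ?R A \<and> y \<in> ?R B}"
    by (rule dim_subset)
  also have "\<dots> \<le> dim (?R A) + dim (?R B)"
    using dim_sums_Int[OF sub[of A] sub[of B]] by linarith
  finally show ?thesis by (simp add: rank_dim_range)
qed

lemma rank_scaleR_le: "rank (c *\<^sub>R A) \<le> rank (A :: real^'n^'m)"
proof -
  have "c *\<^sub>R A = A ** (c *\<^sub>R mat 1)" by (simp add: matrix_mult_scaleR_right)
  then show ?thesis by (metis rank_mul_le_left)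
qed

lemma rank_gram_le: "rank (A ** transpose B) \<le> CARD('r)" for A B :: "real^'r^'p"
  using rank_mul_le_left[of A "transpose B"] rank_bound[of A] by linarith

lemma norm_mult_orthogonal: "orthogonal_matrix Q \<Longrightarrow> norm (A ** Q) = norm (A :: real^'r^'p)"
  unfolding norm_eq_sqrt_inner inner_mult_left
  by (simp add: matrix_mul_assoc[symmetric] orthogonal_matrix_def)

lemma gram_mult_orthogonal:
  fixes Y :: "real^'r^'p"
  assumes "orthogonal_matrix Q"
  shows "(Y ** Q) ** transpose (Y ** Q) = Y ** transpose Y"
proof -
  have "(Y ** Q) ** transpose (Y ** Q) = Y ** (Q ** transpose Q) ** transpose Y"
    by (simp only: matrix_transpose_mul matrix_mul_assoc)
  then show ?thesis using assms by (simp add: orthogonal_matrix_def)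
qed

lemma norm_orthogonal_vec: "orthogonal_matrix Q \<Longrightarrow> norm ((Q::real^'r^'r) *v x) = norm x"
proof -
  assume "orthogonal_matrix Q"
  then have "(Q *v x) \<bullet> (Q *v x) = x \<bullet> x"
    by (metis dot_lmul_matrix matrix_vector_mul_assoc matrix_vector_mul_lid orthogonal_matrix
        vector_transpose_matrix inner_commute)
  then show ?thesis by (simp add: norm_eq_sqrt_inner)
qed

lemma matrix_vector_mult_minus: "(- A) *v x = - (A *v (x::real^'n))"
  by (simp add: matrix_vector_mult_def vec_eq_iff sum_negf)

text \<open>Nonzero singular values of a skew matrix come in equal pairs, so its operator norm is at
  most its Frobenius norm divided by \<open>sqrt 2\<close>. The proof avoids spectral theory by
  testing \<open>K\<close> against one skew matrix of rank at most two.\<close>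

lemma norm_skew_vec_le:
  fixes K :: "real^'n^'n"
  assumes skew: "transpose K = - K"
  shows "2 * (norm (K *v x))\<^sup>2 \<le> (norm K)\<^sup>2 * (norm x)\<^sup>2"
proof -
  define y where "y = K *v x"
  \<comment> \<open>\<open>W = y x\<^sup>T - x y\<^sup>T\<close>. Since \<open>y\<close> is
    orthogonal to \<open>x\<close>, Cauchy-Schwarz for \<open>K\<close> and \<open>W\<close> gives
    the claim after cancelling a factor \<open>2 * (norm y)\<^sup>2\<close>.\<close>
  define W :: "real^'n^'n" where "W = (\<chi> i j. y $ i * x $ j - x $ i * y $ j)"
  have dot: "u \<bullet> (K *v v) = - ((K *v u) \<bullet> v)" for u v
  proof -
    have "u \<bullet> (K *v v) = (transpose K *v u) \<bullet> v"
      by (metis dot_lmul_matrix transpose_matrix_vector)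
    then show ?thesis by (simp add: skew matrix_vector_mult_minus)
  qed
  have yx: "y \<bullet> x = 0" using dot[of x x] by (simp add: y_def inner_commute)
  have rank1: "A \<bullet> (\<chi> i j. u $ i * v $ j) = u \<bullet> (A *v v)" for A :: "real^'n^'n" and u v
    unfolding inner_mat inner_vec_def[of u] matrix_vector_mult_def
    by (simp add: sum_distrib_left ac_simps)
  have W: "W = (\<chi> i j. y $ i * x $ j) - (\<chi> i j. x $ i * y $ j)"
    by (simp add: W_def vec_eq_iff)
  have "K \<bullet> W = y \<bullet> (K *v x) - x \<bullet> (K *v y)"
    by (simp add: W inner_diff_right rank1)
  also have "\<dots> = 2 * (norm y)\<^sup>2" using dot[of x y] by (simp add: y_def power2_norm_eq_inner)
  finally have KW: "K \<bullet> W = 2 * (norm y)\<^sup>2" .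
  have app: "(\<chi> i j. u $ i * v $ j) *v w = (v \<bullet> w) *\<^sub>R u" for u v w :: "real^'n"
    by (simp add: matrix_vector_mult_def inner_vec_def vec_eq_iff sum_distrib_left sum_distrib_right ac_simps)
  have "W \<bullet> W = 2 * (norm x)\<^sup>2 * (norm y)\<^sup>2"
    using yx by (subst (2) W)
      (simp add: inner_diff_right rank1 W matrix_vector_mult_diff_rdistrib app inner_commute
        power2_norm_eq_inner)
  then have "(norm W)\<^sup>2 = 2 * (norm x)\<^sup>2 * (norm y)\<^sup>2" by (simp add: power2_norm_eq_inner)
  moreover have "(2 * (norm y)\<^sup>2)\<^sup>2 \<le> (norm K)\<^sup>2 * (norm W)\<^sup>2"
    using Cauchy_Schwarz_ineq[of K W] KW by (simp add: power2_norm_eq_inner)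
  ultimately have le: "(2 * (norm y)\<^sup>2) * (2 * (norm y)\<^sup>2) \<le> ((norm K)\<^sup>2 * (norm x)\<^sup>2) * (2 * (norm y)\<^sup>2)"
    by (simp add: power2_eq_square ac_simps)
  show ?thesis
  proof (cases "y = 0")
    case False
    then show ?thesis using mult_right_le_imp_le[OF le] by (simp add: y_def)
  qed (simp add: y_def[symmetric])
qed

text \<open>Pairing the skew matrix \<open>K\<close> with itself collapses to
  \<open>2 * (B \<bullet> (A ** K))\<close>, where the operator norm of \<open>K\<close> costs only
  \<open>norm K / sqrt 2\<close>. This improves the triangle inequality by a factor 2 in the
  square.\<close>

lemma norm_skew_mult_le:
  fixes A B :: "real^'r^'p"
  shows "(norm (transpose A ** B - transpose B ** A))\<^sup>2 \<le> 2 * (norm A)\<^sup>2 * (norm B)\<^sup>2"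
proof -
  define K where "K = transpose A ** B - transpose B ** A"
  have skew: "transpose K = - K" by (simp add: K_def transpose_diff matrix_transpose_mul)
  have "(transpose B ** A) \<bullet> K = (transpose A ** B) \<bullet> transpose K"
    using inner_transpose[of "transpose B ** A" K] by (simp add: matrix_transpose_mul)
  then have "K \<bullet> K = 2 * ((transpose A ** B) \<bullet> K)"
    by (subst (1) K_def) (simp add: inner_diff_left skew)
  also have "\<dots> = 2 * (B \<bullet> (A ** K))" by (simp add: inner_mult_right)
  also have "\<dots> \<le> 2 * (norm B * norm (A ** K))" using norm_cauchy_schwarz by simp
  finally have 1: "(norm K)\<^sup>2 \<le> 2 * (norm B * norm (A ** K))" by (simp add: power2_norm_eq_inner)
  have "norm (K ** transpose A) \<le> (norm K / sqrt 2) * norm (transpose A)"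
  proof (rule norm_matrix_mult_le_op)
    fix x
    have "(norm (K *v x))\<^sup>2 \<le> (norm K / sqrt 2 * norm x)\<^sup>2"
      using norm_skew_vec_le[OF skew, of x] by (simp add: power_mult_distrib power_divide)
    then show "norm (K *v x) \<le> norm K / sqrt 2 * norm x" by (rule power2_le_imp_le) simp
  qed simp
  \<comment> \<open>Transposing puts \<open>K\<close> on the left, where the columnwise estimate
    applies.\<close>
  moreover have "K ** transpose A = - transpose (A ** K)"
    by (simp add: matrix_transpose_mul skew bounded_bilinear.minus_left[OF bounded_bilinear_matrix_mult])
  ultimately have "norm (A ** K) \<le> norm K / sqrt 2 * norm A" by (simp add: norm_transpose)
  then have "(norm K)\<^sup>2 \<le> 2 * (norm B * (norm K / sqrt 2 * norm A))"
    using 1 by (smt (verit) mult_left_mono norm_ge_zero)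
  also have "\<dots> = norm K * (sqrt 2 * norm A * norm B)"
    by (simp add: field_simps)
  finally have "norm K \<le> sqrt 2 * norm A * norm B"
    by (cases "K = 0") (simp_all add: power2_eq_square)
  then have "(norm K)\<^sup>2 \<le> (sqrt 2 * norm A * norm B)\<^sup>2" by (rule power_mono) simp
  then show ?thesis by (simp add: K_def power_mult_distrib)
qed

section \<open>The quotient distance and alignment\<close>

lemma orthogonal_matrix_mult:
  fixes A B :: "real^'r^'r"
  assumes "orthogonal_matrix A" "orthogonal_matrix B"
  shows "orthogonal_matrix (A ** B)"
  using assms unfolding orthogonal_matrix
  by (metis matrix_mul_assoc matrix_mul_rid matrix_transpose_mul)

lemma compact_orthogonal_matrix: "compact {Q :: real^'r^'r. orthogonal_matrix Q}"
proof -
  have "continuous_on UNIV (\<lambda>Q::real^'r^'r. transpose Q ** Q)"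
    by (intro bounded_bilinear.continuous_on[OF bounded_bilinear_matrix_mult] continuous_on_id
        linear_continuous_on bounded_linear_transpose)
  then have "closed {Q :: real^'r^'r. transpose Q ** Q = mat 1}"
    by (intro closed_Collect_eq) auto
  moreover have "bounded {Q :: real^'r^'r. orthogonal_matrix Q}"
  proof (rule boundedI)
    fix Q :: "real^'r^'r" assume "Q \<in> {Q. orthogonal_matrix Q}"
    then show "norm Q \<le> norm (mat 1 :: real^'r^'r)"
      using norm_mult_orthogonal[of Q "mat 1 :: real^'r^'r"] by simp
  qed
  ultimately show ?thesis by (simp add: compact_eq_bounded_closed orthogonal_matrix)
qed

lemma qdist_le:
  assumes "orthogonal_matrix Q"
  shows "qdist Y1 Y2 \<le> norm (Y2 ** Q - Y1)"
  unfolding qdist_def by (rule cINF_lower) (auto simp: assms intro!: bdd_belowI[of _ 0])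

text \<open>The orthogonal group is compact, so the infimum in \<open>qdist\<close> is a
  minimum.\<close>

lemma qdist_attained:
  obtains Q where "orthogonal_matrix Q" "qdist Y1 Y2 = norm (Y2 ** Q - Y1)"
proof -
  have "continuous_on {Q. orthogonal_matrix Q} (\<lambda>Q. norm (Y2 ** Q - Y1))"
    by (intro continuous_intros bounded_bilinear.continuous_on[OF bounded_bilinear_matrix_mult])
  then obtain Q where Q: "orthogonal_matrix Q"
    and min: "\<And>Q'. orthogonal_matrix Q' \<Longrightarrow> norm (Y2 ** Q - Y1) \<le> norm (Y2 ** Q' - Y1)"
    using continuous_attains_inf[OF compact_orthogonal_matrix] orthogonal_matrix_id
    by (metis (no_types, lifting) empty_iff mem_Collect_eq)
  have "norm (Y2 ** Q - Y1) \<le> qdist Y1 Y2"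
    unfolding qdist_def by (rule cINF_greatest) (use Q min in auto)
  then have "qdist Y1 Y2 = norm (Y2 ** Q - Y1)" using qdist_le[OF Q] by (rule antisym[rotated])
  then show thesis using that Q by blast
qed

lemma qdist_nonneg: "0 \<le> qdist Y1 Y2"
  using qdist_attained[of Y1 Y2] by (metis norm_ge_zero)

text \<open>Lipschitz dependence on the representative, with constant 1: the rotation optimal for
  \<open>B\<close> is a competitor for \<open>A\<close>.\<close>

lemma qdist_triangle_norm: "qdist A Z \<le> qdist B Z + norm (A - B)"
proof -
  obtain Q where Q: "orthogonal_matrix Q" "qdist B Z = norm (Z ** Q - B)"
    by (rule qdist_attained)
  have "qdist A Z \<le> norm ((Z ** Q - B) - (A - B))" using qdist_le[OF Q(1), of A Z] by simp
  also have "\<dots> \<le> qdist B Z + norm (A - B)" unfolding Q(2) by (rule norm_triangle_ineq4)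
  finally show ?thesis .
qed

lemma qdist_mult_left:
  assumes "orthogonal_matrix Q"
  shows "qdist (A ** Q) Z = qdist A Z"
proof -
  have le: "qdist (A ** Q) Z \<le> qdist A Z" if Q: "orthogonal_matrix Q" for A Q
  proof -
    obtain R where R: "orthogonal_matrix R" "qdist A Z = norm (Z ** R - A)"
      by (rule qdist_attained)
    have "qdist (A ** Q) Z \<le> norm (Z ** (R ** Q) - A ** Q)"
      by (rule qdist_le) (simp add: orthogonal_matrix_mult R Q)
    also have "\<dots> = norm ((Z ** R - A) ** Q)"
      by (simp add: matrix_linear_simps matrix_mul_assoc)
    finally show ?thesis by (simp add: norm_mult_orthogonal Q R)
  qed
  have "A = (A ** Q) ** transpose Q"
    using assms by (simp add: orthogonal_matrix_def matrix_mul_assoc[symmetric])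
  then have "qdist A Z \<le> qdist (A ** Q) Z"
    using le[of "transpose Q" "A ** Q"] assms by (metis orthogonal_matrix_transpose)
  with le[OF assms] show ?thesis by (rule antisym)
qed

lemma qdist_mult_right:
  assumes "orthogonal_matrix Q"
  shows "qdist A (Z ** Q) = qdist A Z"
proof -
  have le: "qdist A Z \<le> qdist A (Z ** Q)" if Q: "orthogonal_matrix Q" for Z Q
  proof -
    obtain R where R: "orthogonal_matrix R" "qdist A (Z ** Q) = norm (Z ** Q ** R - A)"
      by (rule qdist_attained)
    then show ?thesis
      using qdist_le[OF orthogonal_matrix_mult[OF Q R(1)], of A Z] by (simp add: matrix_mul_assoc)
  qed
  have "Z = (Z ** Q) ** transpose Q"
    using assms by (simp add: orthogonal_matrix_def matrix_mul_assoc[symmetric])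
  then have "qdist A (Z ** Q) \<le> qdist A Z"
    using le[of "transpose Q" "Z ** Q"] assms by (metis orthogonal_matrix_transpose)
  with le[OF assms] show ?thesis by (intro antisym)
qed

text \<open>The part of the symmetry of \<open>qdist\<close> that is needed: the rotation may sit on
  the first argument instead of the second.\<close>

lemma qdist_mult_commute_le:
  assumes "orthogonal_matrix Q"
  shows "qdist Z W \<le> norm (W - Z ** Q)"
proof -
  have "qdist Z W = qdist (Z ** Q) W" using qdist_mult_left[OF assms] by metis
  also have "\<dots> \<le> norm (W ** mat 1 - Z ** Q)" by (rule qdist_le) (rule orthogonal_matrix_id)
  finally show ?thesis by simp
qed

lemma qdist_triangle: "qdist A B \<le> qdist A Z + qdist B Z"
proof -
  obtain R where R: "orthogonal_matrix R" "qdist A Z = norm (Z ** R - A)"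
    by (rule qdist_attained)
  obtain P where P: "orthogonal_matrix P" "qdist B Z = norm (Z ** P - B)"
    by (rule qdist_attained)
  have "qdist A B \<le> qdist (Z ** R) B + norm (A - Z ** R)" by (rule qdist_triangle_norm)
  also have "qdist (Z ** R) B = qdist Z B" by (rule qdist_mult_left[OF R(1)])
  also have "qdist Z B \<le> norm (B - Z ** P)" by (rule qdist_mult_commute_le[OF P(1)])
  finally show ?thesis using R(2) P(2) by (simp add: norm_minus_commute)
qed

lemma cls_mult: "orthogonal_matrix Q \<Longrightarrow> cls (Y ** Q) = cls Y"
proof -
  have sub: "cls (Y ** Q) \<subseteq> cls Y" if "orthogonal_matrix Q" for Y Q
    unfolding cls_def using that orthogonal_matrix_mult by (auto simp: matrix_mul_assoc[symmetric])
  assume Q: "orthogonal_matrix Q"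
  then have "Y = (Y ** Q) ** transpose Q"
    by (simp add: orthogonal_matrix_def matrix_mul_assoc[symmetric])
  then have "cls Y \<subseteq> cls (Y ** Q)"
    using sub[of "transpose Q" "Y ** Q"] Q by (metis orthogonal_matrix_transpose)
  with sub[OF Q] show ?thesis by blast
qed

lemma cls_eqE:
  assumes "cls Y = cls Z"
  obtains Q where "orthogonal_matrix Q" "Y = Z ** Q"
proof -
  have "Y = Y ** mat 1" by simp
  then have "Y \<in> cls Y" unfolding cls_def using orthogonal_matrix_id by blast
  then show thesis using that assms by (auto simp: cls_def)
qed

lemma full_rankI:
  fixes Y :: "real^'r^'p"
  assumes "\<And>x. c * norm x \<le> norm (Y *v x)" "0 < c"
  shows "Y \<in> full_rank"
proof -
  have "x = 0" if "Y *v x = 0" for x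
    using assms(1)[of x] assms(2) that by (simp add: mult_le_0_iff)
  then show ?thesis
    unfolding full_rank_def using matrix_nonfull_linear_equations_eq[of Y] by auto
qed

text \<open>
  A substitute for the second-order expansion of the nuclear norm of \<open>Z\<^sup>T c\<close>: the loss caused by
  misalignment is controlled by the skew part of \<open>Z\<^sup>T c\<close> alone.
\<close>

lemma norm_diff_mult_orthogonal_ge:
  fixes c Z :: "real^'r^'p"
  assumes Q: "orthogonal_matrix Q" and lam: "0 < m"
    and pos: "\<And>x. m * (norm x)\<^sup>2 \<le> x \<bullet> ((transpose Z ** c) *v x)"
  shows "(norm (c - Z))\<^sup>2 - (norm (transpose Z ** c - transpose c ** Z))\<^sup>2 / (4 * m)
      \<le> (norm (c - Z ** Q))\<^sup>2"
proof -
  define M where "M = transpose Z ** c"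
  define B where "B = mat 1 - Q"
  define K where "K = M - transpose M"
  have K: "K = transpose Z ** c - transpose c ** Z"
    by (simp add: K_def M_def matrix_transpose_mul)
  have cZ: "c \<bullet> (Z ** R) = M \<bullet> R" for R
    using inner_mult_right[of Z R c] by (simp add: M_def inner_commute)
  have "(Z ** Q) \<bullet> (Z ** Q) = Z \<bullet> Z"
    using norm_mult_orthogonal[OF Q, of Z] by (simp add: norm_eq_sqrt_inner)
  then have "(norm (c - Z ** Q))\<^sup>2 = (norm c)\<^sup>2 + (norm Z)\<^sup>2 - 2 * (M \<bullet> Q)"
    using cZ[of Q]
    by (simp add: power2_norm_eq_inner inner_diff_left inner_diff_right inner_commute)
  moreover have "(norm (c - Z))\<^sup>2 = (norm c)\<^sup>2 + (norm Z)\<^sup>2 - 2 * (M \<bullet> mat 1)"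
    using cZ[of "mat 1"]
    by (simp add: power2_norm_eq_inner inner_diff_left inner_diff_right inner_commute)
  ultimately have 1: "(norm (c - Z ** Q))\<^sup>2 - (norm (c - Z))\<^sup>2 = 2 * (M \<bullet> B)"
    by (simp add: B_def inner_diff_right)
  \<comment> \<open>Orthogonality of \<open>Q\<close> makes the symmetric part of \<open>B\<close>
    quadratic in \<open>B\<close>. Hence the term linear in \<open>B\<close> splits into a quadratic
    form, coercive by \<open>pos\<close>, and a pairing with the skew matrix
    \<open>K\<close>.\<close>
  have BB: "B ** transpose B = B + transpose B"
    using Q by (simp add: B_def matrix_linear_simps orthogonal_matrix_def transpose_mat)
  have "M \<bullet> transpose B = transpose M \<bullet> B" using inner_transpose[of M "transpose B"] by simp
  then have 2: "2 * (M \<bullet> B) = M \<bullet> (B ** transpose B) + K \<bullet> B"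
    by (simp add: BB K_def inner_add_right inner_diff_left)
  have "M \<bullet> (B ** transpose B) = (M ** B) \<bullet> B" by (simp only: inner_mult_left)
  also have "\<dots> = (\<Sum>j\<in>UNIV. column j B \<bullet> (M *v column j B))"
    unfolding inner_columns column_matrix_mult by (intro sum.cong refl inner_commute)
  also have "\<dots> \<ge> (\<Sum>j\<in>UNIV. m * (norm (column j B))\<^sup>2)"
    unfolding M_def by (intro sum_mono pos)
  finally have 3: "m * (norm B)\<^sup>2 \<le> M \<bullet> (B ** transpose B)"
    by (simp add: norm_columns sum_distrib_left)
  have 4: "- (norm K * norm B) \<le> K \<bullet> B" using Cauchy_Schwarz_ineq2[of K B] by linarith
  \<comment> \<open>Completing the square removes the unknown \<open>norm B\<close>.\<close>
  have "0 \<le> (2 * m * norm B - norm K)\<^sup>2" by simp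
  then have "4 * m * (norm K * norm B - m * (norm B)\<^sup>2) \<le> (norm K)\<^sup>2"
    by (simp add: power2_eq_square algebra_simps)
  then have "norm K * norm B - m * (norm B)\<^sup>2 \<le> (norm K)\<^sup>2 / (4 * m)"
    using lam by (simp add: field_simps)
  then show ?thesis using 1 2 3 4 unfolding K by linarith
qed

text \<open>Applied to the identity minus a plane rotation, which has only two nonzero rows.\<close>

lemma inner_sum_two:
  fixes M Q :: "real^'r^'r"
  assumes "i \<noteq> j" and "\<And>k. k \<noteq> i \<Longrightarrow> k \<noteq> j \<Longrightarrow> Q $ k = 0"
  shows "M \<bullet> Q = M $ i \<bullet> Q $ i + M $ j \<bullet> Q $ j"
proof -
  have "M \<bullet> Q = (\<Sum>k\<in>{i, j}. M $ k \<bullet> Q $ k)"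
    unfolding inner_vec_def[of M] by (rule sum.mono_neutral_right) (auto simp: assms)
  then show ?thesis using assms(1) by simp
qed

text \<open>First-order optimality over the plane rotations \<open>c = (1 - t\<^sup>2)/(1 + t\<^sup>2)\<close>, \<open>s = 2t/(1 + t\<^sup>2)\<close>.\<close>

lemma symmetric_if_closest:
  fixes c Z :: "real^'r^'p"
  assumes min: "\<And>Q. orthogonal_matrix Q \<Longrightarrow> norm (Z - c) \<le> norm (Z ** Q - c)"
  shows "transpose (transpose Z ** c) = transpose Z ** c"
proof -
  define M where "M = transpose Z ** c"
  have cZ: "c \<bullet> (Z ** R) = M \<bullet> R" for R
    using inner_mult_right[of Z R c] by (simp add: M_def inner_commute)
  have tr: "M \<bullet> Q \<le> M \<bullet> mat 1" if Q: "orthogonal_matrix Q" for Q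
  proof -
    have "(norm (Z - c))\<^sup>2 \<le> (norm (Z ** Q - c))\<^sup>2" using min[OF Q] by (simp add: power_mono)
    moreover have "(Z ** Q) \<bullet> (Z ** Q) = Z \<bullet> Z"
      using norm_mult_orthogonal[OF Q, of Z] by (simp add: norm_eq_sqrt_inner)
    ultimately show ?thesis using cZ[of Q] cZ[of "mat 1"]
      by (simp add: power2_norm_eq_inner inner_diff_left inner_diff_right inner_commute)
  qed
  have "M $ i $ j = M $ j $ i" if ij: "i \<noteq> j" for i j
  proof -
    define a where "a = M $ i $ i + M $ j $ j"
    define b where "b = M $ i $ j - M $ j $ i"
    \<comment> \<open>The left side has first order in \<open>t\<close> and the right side second
      order, so validity for \<open>t\<close> of both signs forces \<open>b = 0\<close>.\<close>
    have *: "t * b \<le> t\<^sup>2 * a" for t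
    proof -
      define C where "C = (1 - t\<^sup>2) / (1 + t\<^sup>2)"
      define s where "s = 2 * t / (1 + t\<^sup>2)"
      have pos: "0 < 1 + t\<^sup>2" by (simp add: add_pos_nonneg)
      have "(1 - t\<^sup>2)\<^sup>2 + (2 * t)\<^sup>2 = (1 + t\<^sup>2)\<^sup>2"
        by (simp add: power2_eq_square algebra_simps)
      then have cs: "C\<^sup>2 + s\<^sup>2 = 1"
        using pos by (simp add: C_def s_def power_divide add_divide_distrib[symmetric])
      define Q :: "real^'r^'r" where "Q = (\<chi> k. if k = i then C *\<^sub>R axis i 1 + s *\<^sub>R axis j 1
        else if k = j then C *\<^sub>R axis j 1 - s *\<^sub>R axis i 1 else axis k 1)"
      have ax: "axis k (1::real) \<bullet> axis l 1 = (if k = l then 1 else 0)" for k l :: 'r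
        by (simp add: inner_axis_axis)
      have "orthogonal_matrix Q"
        unfolding orthogonal_matrix_orthonormal_rows
      proof (intro conjI allI impI)
        show "norm (row k Q) = 1" for k
          using ij cs by (auto simp: norm_eq_sqrt_inner row_def Q_def
              inner_add_left inner_add_right inner_diff_left inner_diff_right ax power2_eq_square)
        show "orthogonal (row k Q) (row l Q)" if "k \<noteq> l" for k l
          using ij that by (auto simp: orthogonal_def row_def Q_def
              inner_add_left inner_add_right inner_diff_left inner_diff_right ax)
      qed
      then have "0 \<le> M \<bullet> (mat 1 - Q)" using tr by (simp add: inner_diff_right)
      also have "M \<bullet> (mat 1 - Q) = M $ i \<bullet> (mat 1 - Q) $ i + M $ j \<bullet> (mat 1 - Q) $ j"
        by (rule inner_sum_two[OF ij]) (auto simp: Q_def vec_eq_iff mat_def axis_def)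
      also have "(mat 1 - Q) $ i = (1 - C) *\<^sub>R axis i 1 - s *\<^sub>R axis j 1"
        using ij by (auto simp: Q_def vec_eq_iff mat_def axis_def)
      also have "(mat 1 - Q) $ j = (1 - C) *\<^sub>R axis j 1 + s *\<^sub>R axis i 1"
        using ij by (auto simp: Q_def vec_eq_iff mat_def axis_def)
      finally have "s * b \<le> (1 - C) * a"
        by (simp add: inner_add_right inner_diff_right inner_axis a_def b_def algebra_simps)
      moreover have "s * (1 + t\<^sup>2) = 2 * t" "(1 - C) * (1 + t\<^sup>2) = 2 * t\<^sup>2"
        using pos by (simp_all add: s_def C_def field_simps)
      ultimately have "2 * t * b \<le> 2 * t\<^sup>2 * a"
        using mult_right_mono[of "s * b" "(1 - C) * a" "1 + t\<^sup>2"] pos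
        by (metis less_imp_le mult.commute mult.left_commute)
      then show ?thesis by simp
    qed
    have "b = 0"
    proof (rule ccontr)
      assume "b \<noteq> 0"
      \<comment> \<open>Any positive \<open>d\<close> exceeding \<open>a\<close> works:
        \<open>t = b / d\<close> turns the inequality into
        \<open>b\<^sup>2 * d \<le> b\<^sup>2 * a\<close>.\<close>
      define d where "d = \<bar>a\<bar> + 1"
      have d: "0 < d" "a \<le> d - 1" by (auto simp: d_def)
      have "b / d * b \<le> (b / d)\<^sup>2 * a" by (rule *)
      also have "\<dots> \<le> (b / d)\<^sup>2 * (d - 1)" using d by (intro mult_left_mono) auto
      finally have "b\<^sup>2 * d \<le> b\<^sup>2 * (d - 1)"
        using d by (simp add: field_simps power2_eq_square)
      then show False using \<open>b \<noteq> 0\<close> by (simp add: algebra_simps)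
    qed
    then show ?thesis by (simp add: b_def)
  qed
  then have "transpose M = M" by (simp add: vec_eq_iff transpose_def) metis
  then show ?thesis by (simp add: M_def)
qed

text \<open>Replacing \<open>Z\<close> by the optimal \<open>Z ** Q\<close> makes the identity an
  optimal rotation, so the first-order condition applies.\<close>

lemma qdist_aligned:
  obtains Q where "orthogonal_matrix Q" "qdist Y Z = norm (Z ** Q - Y)"
    "transpose (transpose (Z ** Q) ** Y) = transpose (Z ** Q) ** Y"
proof -
  obtain Q where Q: "orthogonal_matrix Q" "qdist Y Z = norm (Z ** Q - Y)"
    by (rule qdist_attained)
  have "norm (Z ** Q - Y) \<le> norm (Z ** Q ** R - Y)" if "orthogonal_matrix R" for R
    using qdist_le[OF that, of Y "Z ** Q"] qdist_mult_right[OF Q(1), of Y Z] Q(2) by simp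
  from symmetric_if_closest[OF this] show thesis using that Q by blast
qed

section \<open>Geodesic convexity of balls\<close>

lemma bounds_mult_orthogonal:
  fixes Z :: "real^'r^'p"
  assumes "orthogonal_matrix Q"
  shows "(\<And>x. norm (Z *v x) \<le> a * norm x) \<Longrightarrow> norm ((Z ** Q) *v x) \<le> a * norm x"
    and "(\<And>x. b * norm x \<le> norm (Z *v x)) \<Longrightarrow> b * norm x \<le> norm ((Z ** Q) *v x)"
  using norm_orthogonal_vec[OF assms]
  by (metis matrix_vector_mul_assoc)+

text \<open>Weyl's perturbation inequalities for the extreme singular values, in vector
  form.\<close>

lemma bounds_perturb:
  fixes Y Z :: "real^'r^'p"
  assumes "norm (Y - Z) \<le> \<rho>"
  shows "(\<And>x. norm (Z *v x) \<le> a * norm x) \<Longrightarrow> norm (Y *v x) \<le> (a + \<rho>) * norm x"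
    and "(\<And>x. b * norm x \<le> norm (Z *v x)) \<Longrightarrow> (b - \<rho>) * norm x \<le> norm (Y *v x)"
proof -
  have Y: "Y *v x = Z *v x + (Y - Z) *v x"
    by (simp add: matrix_vector_mult_diff_rdistrib)
  have E: "norm ((Y - Z) *v x) \<le> \<rho> * norm x"
    using norm_matrix_vector_mult_le[of "Y - Z" x] assms
    by (meson mult_right_mono norm_ge_zero order_trans)
  show "norm (Y *v x) \<le> (a + \<rho>) * norm x" if "\<And>x. norm (Z *v x) \<le> a * norm x"
    using that[of x] E norm_triangle_ineq[of "Z *v x" "(Y - Z) *v x"] unfolding Y
    by (simp add: algebra_simps)
  show "(b - \<rho>) * norm x \<le> norm (Y *v x)" if "\<And>x. b * norm x \<le> norm (Z *v x)"
    using that[of x] E norm_diff_ineq[of "Z *v x" "(Y - Z) *v x"] unfolding Y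
    by (simp add: algebra_simps)
qed

text \<open>
  Near an aligned pair \<open>c, Z\<close>, the squared distance to \<open>[Z]\<close> along a horizontal line is at least
  a strictly convex parabola touching it at \<open>c\<close>.
\<close>

lemma qdist_parabola:
  fixes c Z \<theta> :: "real^'r^'p"
  assumes upper: "\<And>x. norm (Z *v x) \<le> a * norm x" and lower: "\<And>x. b * norm x \<le> norm (Z *v x)"
    and b: "0 < b" and a: "0 \<le> a"
    and hor: "\<theta> \<in> horizontal c"
    and aligned: "transpose (transpose Z ** c) = transpose Z ** c"
    and e: "norm (c - Z) \<le> 2 * b / 3" "a * norm (c - Z) \<le> 2 * b\<^sup>2 / 3"
    and s: "a * (\<bar>s\<bar> * norm \<theta>) \<le> b\<^sup>2 / 24"
  shows "(norm (c - Z + s *\<^sub>R \<theta>))\<^sup>2 - 16 / 21 * s\<^sup>2 * (norm \<theta>)\<^sup>2 \<le> (qdist (c + s *\<^sub>R \<theta>) Z)\<^sup>2"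
proof -
  define c' where "c' = c + s *\<^sub>R \<theta>"
  define E where "E = Z - c"
  \<comment> \<open>\<open>7/24 = 1 - 2/3 - 1/24\<close>: the quadratic form of
    \<open>Z\<^sup>T Z\<close> loses \<open>2/3\<close> through the distance from \<open>c\<close>
    to \<open>Z\<close> and \<open>1/24\<close> through the step.\<close>
  define l where "l = 7 * b\<^sup>2 / 24"
  obtain Q where Q: "orthogonal_matrix Q" "qdist c' Z = norm (Z ** Q - c')"
    by (rule qdist_attained)
  have l0: "0 < l" using b by (simp add: l_def)
  have pos: "l * (norm x)\<^sup>2 \<le> x \<bullet> ((transpose Z ** c') *v x)" for x
  proof -
    have "x \<bullet> ((transpose Z ** c') *v x) = (Z *v x) \<bullet> (c' *v x)"
      by (metis dot_lmul_matrix matrix_vector_mul_assoc transpose_matrix_vector inner_commute)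
    also have "c' *v x = Z *v x - (E - s *\<^sub>R \<theta>) *v x"
      by (simp add: c'_def E_def matrix_vector_mult_diff_rdistrib matrix_vector_mult_add_rdistrib)
    also have "(Z *v x) \<bullet> (Z *v x - (E - s *\<^sub>R \<theta>) *v x)
        = (norm (Z *v x))\<^sup>2 - (Z *v x) \<bullet> ((E - s *\<^sub>R \<theta>) *v x)"
      by (simp add: inner_diff_right power2_norm_eq_inner)
    finally have 1: "x \<bullet> ((transpose Z ** c') *v x) = \<dots>" .
    have "(Z *v x) \<bullet> ((E - s *\<^sub>R \<theta>) *v x) \<le> norm (Z *v x) * norm ((E - s *\<^sub>R \<theta>) *v x)"
      by (rule norm_cauchy_schwarz)
    also have "\<dots> \<le> (a * norm x) * ((norm (c - Z) + \<bar>s\<bar> * norm \<theta>) * norm x)"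
    proof (intro mult_mono upper)
      have "norm (E - s *\<^sub>R \<theta>) \<le> norm (c - Z) + \<bar>s\<bar> * norm \<theta>"
        using norm_triangle_ineq4[of E "s *\<^sub>R \<theta>"] by (simp add: E_def norm_minus_commute)
      then show "norm ((E - s *\<^sub>R \<theta>) *v x) \<le> (norm (c - Z) + \<bar>s\<bar> * norm \<theta>) * norm x"
        using norm_matrix_vector_mult_le[of "E - s *\<^sub>R \<theta>" x]
        by (meson mult_right_mono norm_ge_zero order_trans)
    qed (use a in auto)
    also have "\<dots> = (a * norm (c - Z) + a * (\<bar>s\<bar> * norm \<theta>)) * (norm x)\<^sup>2"
      by (simp add: power2_eq_square algebra_simps)
    also have "\<dots> \<le> (2 * b\<^sup>2 / 3 + b\<^sup>2 / 24) * (norm x)\<^sup>2"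
      using e(2) s by (intro mult_right_mono) auto
    finally have 2: "(Z *v x) \<bullet> ((E - s *\<^sub>R \<theta>) *v x) \<le> (2 * b\<^sup>2 / 3 + b\<^sup>2 / 24) * (norm x)\<^sup>2" .
    have "(b * norm x)\<^sup>2 \<le> (norm (Z *v x))\<^sup>2"
      using lower[of x] b by (intro power_mono) auto
    then have "b\<^sup>2 * (norm x)\<^sup>2 \<le> (norm (Z *v x))\<^sup>2" by (simp add: power_mult_distrib)
    moreover have "l * (norm x)\<^sup>2 = b\<^sup>2 * (norm x)\<^sup>2 - (2 * b\<^sup>2 / 3 + b\<^sup>2 / 24) * (norm x)\<^sup>2"
      by (simp add: l_def algebra_simps)
    ultimately show ?thesis using 1 2 by linarith
  qed
  \<comment> \<open>Alignment removes the constant term, and since \<open>\<theta>\<close> is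
    horizontal at \<open>c\<close>, \<open>Z\<close> may be replaced by \<open>E\<close> in the
    linear one. So the skew part is small both in \<open>s\<close> and in \<open>E\<close>.\<close>
  have "transpose Z ** c' - transpose c' ** Z = s *\<^sub>R (transpose E ** \<theta> - transpose \<theta> ** E)"
    using aligned hor
    by (simp add: c'_def E_def matrix_linear_simps matrix_transpose_mul horizontal_def algebra_simps)
  then have "(norm (transpose Z ** c' - transpose c' ** Z))\<^sup>2
      = s\<^sup>2 * (norm (transpose E ** \<theta> - transpose \<theta> ** E))\<^sup>2"
    by (simp add: power_mult_distrib)
  also have "\<dots> \<le> s\<^sup>2 * (2 * (norm E)\<^sup>2 * (norm \<theta>)\<^sup>2)"
    by (intro mult_left_mono norm_skew_mult_le) simp
  also have "\<dots> \<le> s\<^sup>2 * (2 * (2 * b / 3)\<^sup>2 * (norm \<theta>)\<^sup>2)"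
    using e(1) by (intro mult_left_mono mult_right_mono power_mono) (auto simp: E_def norm_minus_commute)
  \<comment> \<open>\<open>2 * (2/3)\<^sup>2 / (4 * 7/24) = 16/21\<close>.\<close>
  also have "\<dots> = 4 * l * (16 / 21 * s\<^sup>2 * (norm \<theta>)\<^sup>2)"
    by (simp add: l_def power2_eq_square)
  finally have "(norm (transpose Z ** c' - transpose c' ** Z))\<^sup>2 / (4 * l) \<le> 16 / 21 * s\<^sup>2 * (norm \<theta>)\<^sup>2"
    using l0 by (simp add: field_simps)
  moreover have "(norm (c' - Z ** Q))\<^sup>2 \<ge>
      (norm (c' - Z))\<^sup>2 - (norm (transpose Z ** c' - transpose c' ** Z))\<^sup>2 / (4 * l)"
    by (rule norm_diff_mult_orthogonal_ge[OF Q(1) l0 pos])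
  moreover have "c' - Z = c - Z + s *\<^sub>R \<theta>" by (simp add: c'_def)
  ultimately show ?thesis
    unfolding c'_def[symmetric] Q(2) by (simp add: norm_minus_commute)
qed

text \<open>Moving along the line adds only a multiple of the symmetric matrix
  \<open>\<theta>\<^sup>T \<theta>\<close> to \<open>Y\<^sup>T \<theta>\<close>.\<close>

lemma horizontal_line:
  assumes "\<theta> \<in> horizontal Y"
  shows "\<theta> \<in> horizontal (Y + t *\<^sub>R \<theta>)"
  using assms by (simp add: horizontal_def matrix_linear_simps matrix_transpose_mul)

lemma horizontal_diff:
  assumes "transpose (transpose Y2 ** Y1) = transpose Y2 ** Y1"
  shows "Y2 - Y1 \<in> horizontal Y1"
  using assms by (simp add: horizontal_def matrix_linear_simps matrix_transpose_mul)

text \<open>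
  By the triangle inequality the segment stays within \<open>2 * \<rho>\<close> of \<open>[Z]\<close>; there the distance to
  \<open>[Z]\<close> has no interior local maximum, by \<open>qdist_parabola\<close>.
\<close>

lemma qdist_ball_geodesic:
  fixes Y1 Y2 Z :: "real^'r^'p"
  assumes upper: "\<And>x. norm (Z *v x) \<le> a * norm x" and lower: "\<And>x. b * norm x \<le> norm (Z *v x)"
    and b: "0 < b" and a: "0 \<le> a"
    and rho: "\<rho> \<le> b / 3" "a * \<rho> \<le> b\<^sup>2 / 3"
    and d: "qdist Y1 Z \<le> \<rho>" "qdist Y2 Z \<le> \<rho>"
    and hor: "Y2 - Y1 \<in> horizontal Y1" and len: "norm (Y2 - Y1) \<le> 2 * \<rho>"
    and t: "t \<in> {0..1}"
  shows "qdist (Y1 + t *\<^sub>R (Y2 - Y1)) Z \<le> \<rho>"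
proof -
  define \<theta> where "\<theta> = Y2 - Y1"
  define c where "c t = Y1 + t *\<^sub>R \<theta>" for t
  define D where "D t = qdist (c t) Z" for t
  have lip: "\<bar>D s - D t\<bar> \<le> norm \<theta> * \<bar>s - t\<bar>" for s t
  proof -
    have "norm (c s - c t) = norm \<theta> * \<bar>s - t\<bar>"
      by (simp add: c_def scaleR_diff_left[symmetric])
    then show ?thesis
      using qdist_triangle_norm[of "c s" Z "c t"] qdist_triangle_norm[of "c t" Z "c s"]
      by (simp add: D_def norm_minus_commute abs_le_iff)
  qed
  have "continuous_on {0..1} D"
    by (rule lipschitz_on_continuous_on[of "norm \<theta>"])
       (rule lipschitz_onI, simp_all add: dist_real_def lip)
  then obtain t0 where t0: "t0 \<in> {0..1}" and max: "\<And>t. t \<in> {0..1} \<Longrightarrow> D t \<le> D t0"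
    using continuous_attains_sup[of "{0..1}" D] by auto
  have D01: "D 0 \<le> \<rho>" "D 1 \<le> \<rho>" using d by (simp_all add: D_def c_def \<theta>_def)
  have "D t0 \<le> \<rho>"
  proof (rule ccontr)
    assume neg: "\<not> D t0 \<le> \<rho>"
    then have int: "0 < t0" "t0 < 1" using D01 t0 by (auto simp: order_less_le)
    have th: "0 < norm \<theta>"
    proof (rule ccontr)
      assume "\<not> 0 < norm \<theta>"
      then show False using neg D01 by (simp add: D_def c_def)
    qed
    \<comment> \<open>One endpoint is at most half the length of the segment away.\<close>
    have "norm \<theta> * t0 \<le> \<rho> \<or> norm \<theta> * (1 - t0) \<le> \<rho>"
      using len by (simp add: \<theta>_def[symmetric] algebra_simps) linarith
    then have D2: "D t0 \<le> 2 * \<rho>"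
      using lip[of t0 0] lip[of t0 1] D01 int by (auto simp: abs_le_iff)
    have rho0: "0 \<le> \<rho>" using d(1) qdist_nonneg order_trans by blast
    obtain Q where Q: "orthogonal_matrix Q" "D t0 = norm (Z ** Q - c t0)"
      "transpose (transpose (Z ** Q) ** c t0) = transpose (Z ** Q) ** c t0"
      unfolding D_def by (rule qdist_aligned)
    define W where "W = Z ** Q"
    have e: "norm (c t0 - W) = D t0" by (simp add: W_def Q(2) norm_minus_commute)
    \<comment> \<open>Small enough to stay in the interval in both directions and to meet the step
      condition of \<open>qdist_parabola\<close>; \<open>a + 1\<close> keeps the denominator
      positive when \<open>a = 0\<close>.\<close>
    define \<eta> where "\<eta> = min (min t0 (1 - t0)) (b\<^sup>2 / (24 * (a + 1) * norm \<theta>))"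
    have eta: "0 < \<eta>" "\<eta> \<le> t0" "\<eta> \<le> 1 - t0"
      using int b a th by (auto simp: \<eta>_def)
    have "\<eta> \<le> b\<^sup>2 / (24 * (a + 1) * norm \<theta>)" by (simp add: \<eta>_def)
    moreover have "0 < 24 * (a + 1) * norm \<theta>" using a th by simp
    ultimately have "\<eta> * (24 * (a + 1) * norm \<theta>) \<le> b\<^sup>2" by (simp only: pos_le_divide_eq)
    then have "(a + 1) * (\<eta> * norm \<theta>) \<le> b\<^sup>2 / 24" by (simp add: algebra_simps)
    moreover have "a * (\<eta> * norm \<theta>) \<le> (a + 1) * (\<eta> * norm \<theta>)"
      using eta th by (intro mult_right_mono) auto
    ultimately have eta': "a * (\<eta> * norm \<theta>) \<le> b\<^sup>2 / 24" by linarith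
    \<comment> \<open>The sign is chosen so that the linear term of the squared distance does not
      decrease; the remaining quadratic coefficient is \<open>1 - 16/21 = 5/21\<close>, which
      contradicts maximality.\<close>
    define s where "s = (if 0 \<le> (c t0 - W) \<bullet> \<theta> then \<eta> else - \<eta>)"
    have s: "\<bar>s\<bar> = \<eta>" "0 \<le> s * ((c t0 - W) \<bullet> \<theta>)" "t0 + s \<in> {0..1}"
      using eta int by (auto simp: s_def mult_nonneg_nonneg mult_le_0_iff)
    have "(norm (c t0 - W + s *\<^sub>R \<theta>))\<^sup>2 - 16 / 21 * s\<^sup>2 * (norm \<theta>)\<^sup>2 \<le> (qdist (c t0 + s *\<^sub>R \<theta>) W)\<^sup>2"
    proof (rule qdist_parabola[where a = a and b = b])
      show "norm (W *v x) \<le> a * norm x" "b * norm x \<le> norm (W *v x)" for x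
        unfolding W_def by (intro bounds_mult_orthogonal[OF Q(1)] upper lower)+
      show "\<theta> \<in> horizontal (c t0)" unfolding c_def \<theta>_def by (rule horizontal_line[OF hor])
      show "transpose (transpose W ** c t0) = transpose W ** c t0" unfolding W_def by (rule Q(3))
      show "norm (c t0 - W) \<le> 2 * b / 3" using e D2 rho by simp
      have "a * D t0 \<le> a * (2 * \<rho>)" using D2 a by (rule mult_left_mono)
      then show "a * norm (c t0 - W) \<le> 2 * b\<^sup>2 / 3" using e rho by simp
      show "a * (\<bar>s\<bar> * norm \<theta>) \<le> b\<^sup>2 / 24" using eta' s by simp
    qed (use a b in auto)
    moreover have "(qdist (c t0 + s *\<^sub>R \<theta>) W)\<^sup>2 = (D (t0 + s))\<^sup>2"
      by (simp add: D_def W_def c_def qdist_mult_right[OF Q(1)] algebra_simps)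
    moreover have "(norm (c t0 - W + s *\<^sub>R \<theta>))\<^sup>2
        = (D t0)\<^sup>2 + 2 * (s * ((c t0 - W) \<bullet> \<theta>)) + s\<^sup>2 * (norm \<theta>)\<^sup>2"
      unfolding e[symmetric] power2_norm_eq_inner
      by (simp add: inner_add_left inner_add_right inner_commute power2_eq_square algebra_simps)
    moreover have "0 < 5 / 21 * s\<^sup>2 * (norm \<theta>)\<^sup>2"
      using s eta th by (auto simp: zero_less_mult_iff)
    ultimately have "(D t0)\<^sup>2 < (D (t0 + s))\<^sup>2"
      using s(2) by linarith
    then have "D t0 < D (t0 + s)" using power_less_imp_less_base qdist_nonneg D_def by metis
    with max[OF s(3)] show False by simp
  qed
  then show ?thesis using max[OF t] by (simp add: D_def c_def \<theta>_def)
qed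

section \<open>Symmetry and polarisation of the Hessian\<close>

lemma ehess_works:
  fixes f :: "'a::euclidean_space \<Rightarrow> real"
  assumes "egrad f differentiable (at x)"
  shows "(egrad f has_derivative frechet_derivative (egrad f) (at x)) (at x)"
  using assms frechet_derivative_works by blast

lemma ehess_bilinear:
  fixes f :: "'a::euclidean_space \<Rightarrow> real"
  assumes "egrad f differentiable (at x)"
  shows "ehess f x (u + u') v = ehess f x u v + ehess f x u' v"
    and "ehess f x (u - u') v = ehess f x u v - ehess f x u' v"
    and "ehess f x (k *\<^sub>R u) v = k * ehess f x u v"
    and "ehess f x u (v + v') = ehess f x u v + ehess f x u v'"
    and "ehess f x u (v - v') = ehess f x u v - ehess f x u v'"
    and "ehess f x u (k *\<^sub>R v) = k * ehess f x u v"
proof -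
  have lin: "linear (frechet_derivative (egrad f) (at x))"
    using ehess_works[OF assms] by (rule has_derivative_linear)
  show "ehess f x (u + u') v = ehess f x u v + ehess f x u' v"
    "ehess f x (u - u') v = ehess f x u v - ehess f x u' v"
    "ehess f x (k *\<^sub>R u) v = k * ehess f x u v"
    by (simp_all add: ehess_def linear_add[OF lin] linear_diff[OF lin] linear_cmul[OF lin]
        inner_add_left inner_diff_left)
qed (simp_all add: ehess_def inner_add_right inner_diff_right)

lemma DERIV_egrad_line:
  fixes f :: "'a::euclidean_space \<Rightarrow> real"
  assumes "f differentiable (at (x + t *\<^sub>R v))"
  shows "((\<lambda>t. f (x + t *\<^sub>R v)) has_real_derivative egrad f (x + t *\<^sub>R v) \<bullet> v) (at t)"
proof -
  have "((\<lambda>t. x + t *\<^sub>R v) has_derivative (\<lambda>h. h *\<^sub>R v)) (at t)"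
    by (auto intro!: derivative_eq_intros)
  from has_derivative_compose[OF this egrad_works[OF assms, unfolded gderiv_def]]
  show ?thesis by (simp add: has_field_derivative_def inner_commute mult_commute_abs)
qed

text \<open>The second difference is symmetric in \<open>u\<close> and \<open>v\<close>, its expansion below is not; comparing both orders
  gives \<open>ehess_sym\<close>.\<close>

lemma second_difference_bound:
  fixes f :: "'a::euclidean_space \<Rightarrow> real"
  assumes d: "\<And>x. f differentiable (at x)" and d2: "egrad f differentiable (at x)" and e: "0 < e"
  shows "\<forall>\<^sub>F t in at_right 0. \<bar>(f (x + t *\<^sub>R u + t *\<^sub>R v) - f (x + t *\<^sub>R u) - f (x + t *\<^sub>R v) + f x)
      - t\<^sup>2 * ehess f x u v\<bar> \<le> t\<^sup>2 * (e * ((norm u + 2 * norm v) * norm v))"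
proof -
  define D where "D = frechet_derivative (egrad f) (at x)"
  have D: "(egrad f has_derivative D) (at x)"
    unfolding D_def by (rule ehess_works[OF d2])
  then have lin: "linear D" by (rule has_derivative_linear)
  obtain r where r: "0 < r"
    and rem: "\<And>y. norm (y - x) < r \<Longrightarrow> norm (egrad f y - egrad f x - D (y - x)) \<le> e * norm (y - x)"
    using D[unfolded has_derivative_at_alt] e by blast
  \<comment> \<open>Keeps \<open>x + t u + s v\<close> and \<open>x + s v\<close> within
    \<open>r\<close> of \<open>x\<close> for \<open>0 < s < t\<close>; the added 1 covers
    \<open>u = v = 0\<close>.\<close>
  define r' where "r' = r / (norm u + norm v + 1)"
  have r': "0 < r'" using r by (simp add: r'_def add_nonneg_pos)
  have "\<bar>(f (x + t *\<^sub>R u + t *\<^sub>R v) - f (x + t *\<^sub>R u) - f (x + t *\<^sub>R v) + f x) - t\<^sup>2 * ehess f x u v\<bar>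
      \<le> t\<^sup>2 * (e * ((norm u + 2 * norm v) * norm v))" if t: "0 < t" "t < r'" for t
  proof -
    \<comment> \<open>The mean value theorem for \<open>\<psi>\<close> turns the second difference
      into a difference of gradients at two points near \<open>x\<close>, where the expansion of the
      gradient at \<open>x\<close> applies to each.\<close>
    define \<psi> where "\<psi> s = f (x + t *\<^sub>R u + s *\<^sub>R v) - f (x + s *\<^sub>R v)" for s
    define \<psi>' where "\<psi>' s = egrad f (x + t *\<^sub>R u + s *\<^sub>R v) \<bullet> v - egrad f (x + s *\<^sub>R v) \<bullet> v" for s
    have "(\<psi> has_real_derivative \<psi>' s) (at s)" for s
      unfolding \<psi>_def \<psi>'_def by (intro DERIV_diff DERIV_egrad_line d)
    then obtain s where s: "0 < s" "s < t" "\<psi> t - \<psi> 0 = (t - 0) * \<psi>' s"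
      using MVT2[of 0 t \<psi> \<psi>'] t by blast
    have small: "t * (norm u + norm v) < r"
    proof -
      have "t * (norm u + norm v + 1) < r"
        using t(2) by (simp add: r'_def pos_less_divide_eq add_nonneg_pos)
      then show ?thesis using t(1) by (simp add: algebra_simps)
    qed
    define p where "p = egrad f (x + t *\<^sub>R u + s *\<^sub>R v) - egrad f x - D (t *\<^sub>R u + s *\<^sub>R v)"
    define q where "q = egrad f (x + s *\<^sub>R v) - egrad f x - D (s *\<^sub>R v)"
    have sv: "norm (s *\<^sub>R v) \<le> t * norm v" using s by (simp add: mult_right_mono)
    have tusv: "norm (t *\<^sub>R u + s *\<^sub>R v) \<le> t * (norm u + norm v)"
      using norm_triangle_ineq[of "t *\<^sub>R u" "s *\<^sub>R v"] sv t by (simp add: algebra_simps)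
    have "t * norm v \<le> t * (norm u + norm v)" using t by simp
    then have "norm (s *\<^sub>R v) < r" using sv small by linarith
    then have "norm q \<le> e * norm (s *\<^sub>R v)" using rem[of "x + s *\<^sub>R v"] by (simp add: q_def)
    also have "\<dots> \<le> e * (t * norm v)" using sv e by (intro mult_left_mono) auto
    finally have q: "norm q \<le> e * (t * norm v)" .
    have "norm (t *\<^sub>R u + s *\<^sub>R v) < r" using tusv small by linarith
    then have "norm p \<le> e * norm (t *\<^sub>R u + s *\<^sub>R v)"
      using rem[of "x + t *\<^sub>R u + s *\<^sub>R v"] by (simp add: p_def add.assoc)
    also have "\<dots> \<le> e * (t * (norm u + norm v))" using tusv e by (intro mult_left_mono) auto
    finally have p: "norm p \<le> e * (t * (norm u + norm v))" .
    have "\<psi>' s - t * ehess f x u v = (p - q) \<bullet> v"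
      by (simp add: \<psi>'_def p_def q_def ehess_def D_def[symmetric] linear_add[OF lin]
          linear_cmul[OF lin] inner_diff_left inner_add_left)
    then have "\<bar>\<psi>' s - t * ehess f x u v\<bar> \<le> norm (p - q) * norm v"
      by (simp add: Cauchy_Schwarz_ineq2)
    also have "\<dots> \<le> (e * (t * (norm u + norm v)) + e * (t * norm v)) * norm v"
      using norm_triangle_ineq4[of p q] p q by (intro mult_right_mono) auto
    also have "\<dots> = t * (e * ((norm u + 2 * norm v) * norm v))"
      by (simp add: algebra_simps)
    finally have "t * \<bar>\<psi>' s - t * ehess f x u v\<bar> \<le> t * (t * (e * ((norm u + 2 * norm v) * norm v)))"
      using t by (intro mult_left_mono) auto
    moreover have "t * \<bar>\<psi>' s - t * ehess f x u v\<bar> = \<bar>t * (\<psi>' s - t * ehess f x u v)\<bar>"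
      using t by (simp add: abs_mult)
    moreover have "t * (\<psi>' s - t * ehess f x u v) = (\<psi> t - \<psi> 0) - t\<^sup>2 * ehess f x u v"
      using s(3) by (simp add: power2_eq_square algebra_simps)
    ultimately show ?thesis by (simp add: \<psi>_def power2_eq_square algebra_simps)
  qed
  then show ?thesis
    unfolding eventually_at_right_field using r' by auto
qed

text \<open>Polarisation needs this: \<open>ehess\<close> is read off from the derivative of the
  gradient and is not symmetric by construction.\<close>

lemma ehess_sym:
  fixes f :: "'a::euclidean_space \<Rightarrow> real"
  assumes d: "\<And>x. f differentiable (at x)" and d2: "egrad f differentiable (at x)"
  shows "ehess f x u v = ehess f x v u"
proof -
  define C where "C = (norm u + 2 * norm v) * norm v + (norm v + 2 * norm u) * norm u"
  have "\<bar>ehess f x u v - ehess f x v u\<bar> \<le> e" if e: "0 < e" for e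
  proof -
    have C: "0 \<le> C" by (simp add: C_def)
    define k where "k = e / (C + 1)"
    have k: "0 < k" "k * C \<le> e" using e C by (auto simp: k_def field_simps)
    have "\<forall>\<^sub>F t in at_right (0::real). 0 < t" by (simp add: eventually_at_right_less)
    with second_difference_bound[OF d d2 k(1), of u v] second_difference_bound[OF d d2 k(1), of v u]
    have "\<forall>\<^sub>F t in at_right (0::real). \<bar>ehess f x u v - ehess f x v u\<bar> \<le> k * C"
    proof eventually_elim
      case (elim t)
      have "f (x + t *\<^sub>R u + t *\<^sub>R v) = f (x + t *\<^sub>R v + t *\<^sub>R u)" by (simp add: ac_simps)
      then have "\<bar>t\<^sup>2 * ehess f x u v - t\<^sup>2 * ehess f x v u\<bar> \<le> t\<^sup>2 * (k * C)"
        using elim(1,2) unfolding C_def distrib_left[of _ "_ * _" "_ * _"] by linarith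
      then have "t\<^sup>2 * \<bar>ehess f x u v - ehess f x v u\<bar> \<le> t\<^sup>2 * (k * C)"
        by (simp add: right_diff_distrib[symmetric] abs_mult)
      then show ?case using elim(3) by simp
    qed
    then have "\<bar>ehess f x u v - ehess f x v u\<bar> \<le> k * C"
      by (rule eventually_const[THEN iffD1, rotated]) simp
    then show ?thesis using k by linarith
  qed
  then show ?thesis using field_le_epsilon[of "\<bar>ehess f x u v - ehess f x v u\<bar>" 0] by auto
qed

text \<open>Polarisation: sums and differences of the two directions have rank at most
  \<open>4 * r\<close>, where the Hessian differs from the squared norm by a relative error
  \<open>\<delta>\<close>.\<close>

lemma restricted_ehess_near_inner:
  fixes f :: "real^'p^'p \<Rightarrow> real"
  assumes C2: "twice_cont_diff f"
    and restr: "restricted_convex_smooth (2 * r) (4 * r) \<delta> f" and delta: "0 \<le> \<delta>"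
    and rk: "rank X \<le> 2 * r" "rank A \<le> 2 * r" "rank B \<le> 2 * r"
  shows "\<bar>ehess f X A B - A \<bullet> B\<bar> \<le> \<delta> * norm A * norm B"
proof (cases "A = 0 \<or> B = 0")
  case True
  have d2: "egrad f differentiable (at X)" using C2 by (simp add: twice_cont_diff_def)
  have "ehess f X 0 B = 0" "ehess f X A 0 = 0"
    using ehess_bilinear(3)[OF d2, of 0 0 B] ehess_bilinear(6)[OF d2, of A 0 0] by simp_all
  then show ?thesis using True by auto
next
  case False
  have d: "\<And>x. f differentiable (at x)" and d2: "egrad f differentiable (at X)"
    using C2 by (auto simp: twice_cont_diff_def)
  note bl = ehess_bilinear[OF d2]
  \<comment> \<open>Unit vectors make the parallelogram identity yield exactly 4, which cancels the
    4 of polarisation and leaves a product of norms rather than a sum of squares.\<close>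
  define P where "P = A /\<^sub>R norm A"
  define R where "R = B /\<^sub>R norm B"
  have n: "norm P = 1" "norm R = 1" using False by (auto simp: P_def R_def)
  have rk': "rank P \<le> 2 * r" "rank R \<le> 2 * r" "rank (- R) \<le> 2 * r"
    using rank_scaleR_le[of "inverse (norm A)" A] rank_scaleR_le[of "inverse (norm B)" B]
      rank_scaleR_le[of "- 1" R] rk unfolding P_def R_def by simp_all
  have T: "\<bar>ehess f X G G - (norm G)\<^sup>2\<bar> \<le> \<delta> * (norm G)\<^sup>2" if "rank G \<le> 4 * r" for G
  proof -
    have "(1 - \<delta>) * (norm G)\<^sup>2 \<le> ehess f X G G \<and> ehess f X G G \<le> (1 + \<delta>) * (norm G)\<^sup>2"
      using restr rk(1) that by (simp only: restricted_convex_smooth_def)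
    then show ?thesis by (simp add: abs_le_iff algebra_simps)
  qed
  have "rank (P + R) \<le> 4 * r" "rank (P - R) \<le> 4 * r"
    using rank_add_le[of P R] rank_add_le[of P "- R"] rk' by auto
  from T[OF this(1)] T[OF this(2)]
  have "\<bar>(ehess f X (P + R) (P + R) - (norm (P + R))\<^sup>2) - (ehess f X (P - R) (P - R) - (norm (P - R))\<^sup>2)\<bar>
      \<le> \<delta> * ((norm (P + R))\<^sup>2 + (norm (P - R))\<^sup>2)"
    unfolding distrib_left by linarith
  moreover have "(norm (P + R))\<^sup>2 + (norm (P - R))\<^sup>2 = 4"
    using n by (simp add: power2_norm_eq_inner inner_add_left inner_add_right inner_diff_left
        inner_diff_right norm_eq_1)
  moreover have "(norm (P + R))\<^sup>2 - (norm (P - R))\<^sup>2 = 4 * (P \<bullet> R)"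
    by (simp add: power2_norm_eq_inner inner_add_left inner_add_right inner_diff_left
        inner_diff_right inner_commute)
  moreover have "ehess f X (P + R) (P + R) - ehess f X (P - R) (P - R) = 4 * ehess f X P R"
    using ehess_sym[OF d d2, of R P] by (simp add: bl)
  ultimately have PR: "\<bar>ehess f X P R - P \<bullet> R\<bar> \<le> \<delta>" by (simp add: abs_le_iff)
  have "A = norm A *\<^sub>R P" "B = norm B *\<^sub>R R" using False by (auto simp: P_def R_def)
  then have "ehess f X A B - A \<bullet> B = (norm A * norm B) * (ehess f X P R - P \<bullet> R)"
    using bl(3)[of "norm A" P B] bl(6)[of P "norm B" R]
    by (metis inner_scaleR_left inner_scaleR_right mult.assoc right_diff_distrib)
  then have "\<bar>ehess f X A B - A \<bullet> B\<bar> = (norm A * norm B) * \<bar>ehess f X P R - P \<bullet> R\<bar>"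
    by (simp add: abs_mult)
  also have "\<dots> \<le> (norm A * norm B) * \<delta>" by (intro mult_left_mono PR) auto
  finally show ?thesis by (simp add: ac_simps)
qed

text \<open>Only the optimality of \<open>G\<close> against multiples of \<open>G\<close> and of \<open>B\<close> is used.\<close>

lemma best_rank_approx_inner_le:
  fixes A B G :: "real^'n^'m"
  assumes best: "best_rank_approx k A G" and rk: "rank B \<le> k"
  shows "\<bar>A \<bullet> B\<bar> \<le> norm G * norm B"
proof (cases "B = 0")
  case False
  have opt: "(norm (A - G))\<^sup>2 \<le> (norm A)\<^sup>2 - 2 * s * (A \<bullet> C) + s\<^sup>2 * (norm C)\<^sup>2" if "rank C \<le> k" for s C
  proof -
    have "rank (s *\<^sub>R C) \<le> k" using rank_scaleR_le[of s C] that by linarith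
    then have "norm (A - G) \<le> norm (A - s *\<^sub>R C)" using best by (simp add: best_rank_approx_def)
    then have "(norm (A - G))\<^sup>2 \<le> (norm (A - s *\<^sub>R C))\<^sup>2" by (rule power_mono) simp
    also have "\<dots> = (norm A)\<^sup>2 - 2 * s * (A \<bullet> C) + s\<^sup>2 * (norm C)\<^sup>2"
      unfolding power2_norm_eq_inner
      by (simp add: inner_diff_left inner_diff_right inner_commute power2_eq_square algebra_simps)
    finally show ?thesis .
  qed
  have AG: "(norm (A - G))\<^sup>2 = (norm A)\<^sup>2 - 2 * (A \<bullet> G) + (norm G)\<^sup>2"
    by (simp add: power2_norm_eq_inner inner_diff_left inner_diff_right inner_commute)
  \<comment> \<open>The best multiple of \<open>G\<close> must be \<open>G\<close> itself, so the
    residual \<open>A - G\<close> is orthogonal to \<open>G\<close>.\<close>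
  have "(A \<bullet> G) = (norm G)\<^sup>2"
  proof (cases "G = 0")
    case False
    define g where "g = (norm G)\<^sup>2"
    have g: "g > 0" using False by (simp add: g_def)
    have "rank G \<le> k" using best by (simp add: best_rank_approx_def)
    from opt[OF this, of "(A \<bullet> G) / g"]
    have "- 2 * (A \<bullet> G) + g \<le> - 2 * ((A \<bullet> G) / g) * (A \<bullet> G) + ((A \<bullet> G) / g)\<^sup>2 * g"
      using AG by (simp add: g_def)
    also have "\<dots> = - (A \<bullet> G)\<^sup>2 / g" using g by (simp add: power2_eq_square field_simps)
    finally have "((A \<bullet> G) - g)\<^sup>2 \<le> 0" using g
      by (simp add: field_simps power2_eq_square)
    then show ?thesis by (simp add: g_def)
  qed simp
  then have "- (norm G)\<^sup>2 \<le> - 2 * s * (A \<bullet> B) + s\<^sup>2 * (norm B)\<^sup>2" for s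
    using opt[OF rk, of s] AG by simp
  \<comment> \<open>The value of \<open>s\<close> minimising the right side.\<close>
  from this[of "(A \<bullet> B) / (norm B)\<^sup>2"] have "(A \<bullet> B)\<^sup>2 / (norm B)\<^sup>2 \<le> (norm G)\<^sup>2"
    using False by (simp add: power2_eq_square field_simps)
  then have "\<bar>A \<bullet> B\<bar>\<^sup>2 \<le> (norm G * norm B)\<^sup>2"
    using False by (simp add: field_simps power_mult_distrib)
  then show ?thesis by (rule power2_le_imp_le) simp
qed simp

section \<open>Bounds on the Riemannian Hessian\<close>

text \<open>Every point of the line through the two Gram matrices combines them linearly and has
  rank at most \<open>2 * CARD('r)\<close>, so the restricted bound is available wherever the mean
  value theorem evaluates the Hessian.\<close>

lemma egrad_gram_diff_inner_le:
  fixes f :: "real^'p^'p \<Rightarrow> real" and Y Z :: "real^'r^'p"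
  assumes C2: "twice_cont_diff f" and delta: "0 \<le> \<delta>"
    and restr: "restricted_convex_smooth (2 * CARD('r)) (4 * CARD('r)) \<delta> f"
    and W: "rank W \<le> 2 * CARD('r)"
  shows "\<bar>(egrad f (Y ** transpose Y) - egrad f (Z ** transpose Z)) \<bullet> W\<bar>
      \<le> (1 + \<delta>) * norm (Y ** transpose Y - Z ** transpose Z) * norm W"
proof -
  define X where "X = Z ** transpose Z"
  define \<Delta> where "\<Delta> = Y ** transpose Y - X"
  have d2: "\<And>x. egrad f differentiable (at x)" using C2 by (simp add: twice_cont_diff_def)
  have gr: "rank (k *\<^sub>R (A ** transpose A)) \<le> CARD('r)" for k and A :: "real^'r^'p"
    using rank_scaleR_le rank_gram_le order_trans by blast
  have rk: "rank (X + t *\<^sub>R \<Delta>) \<le> 2 * CARD('r)" for t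
  proof -
    have "X + t *\<^sub>R \<Delta> = (1 - t) *\<^sub>R (Z ** transpose Z) + t *\<^sub>R (Y ** transpose Y)"
      by (simp add: X_def \<Delta>_def algebra_simps)
    then show ?thesis
      using rank_add_le[of "(1 - t) *\<^sub>R (Z ** transpose Z)" "t *\<^sub>R (Y ** transpose Y)"]
        gr[of "1 - t" Z] gr[of t Y] by simp
  qed
  have "\<Delta> = 1 *\<^sub>R (Y ** transpose Y) + (- 1) *\<^sub>R (Z ** transpose Z)" by (simp add: \<Delta>_def X_def)
  then have rkD: "rank \<Delta> \<le> 2 * CARD('r)"
    using rank_add_le[of "1 *\<^sub>R (Y ** transpose Y)" "(- 1) *\<^sub>R (Z ** transpose Z)"]
      gr[of 1 Y] gr[of "- 1" Z] by (metis add_mono mult_2 order_trans)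
  define \<phi> where "\<phi> t = egrad f (X + t *\<^sub>R \<Delta>) \<bullet> W" for t
  have "(\<phi> has_real_derivative ehess f (X + t *\<^sub>R \<Delta>) \<Delta> W) (at t)" for t
  proof -
    have "((\<lambda>t. X + t *\<^sub>R \<Delta>) has_derivative (\<lambda>h. h *\<^sub>R \<Delta>)) (at t)"
      by (auto intro!: derivative_eq_intros)
    from has_derivative_compose[OF this ehess_works[OF d2]]
    have "((\<lambda>t. egrad f (X + t *\<^sub>R \<Delta>)) has_derivative
        (\<lambda>h. frechet_derivative (egrad f) (at (X + t *\<^sub>R \<Delta>)) (h *\<^sub>R \<Delta>))) (at t)" .
    from has_derivative_inner_left[OF this, of W]
    have "(\<phi> has_derivative (\<lambda>h. ehess f (X + t *\<^sub>R \<Delta>) (h *\<^sub>R \<Delta>) W)) (at t)"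
      by (simp add: \<phi>_def[abs_def] ehess_def)
    then show ?thesis
      by (simp add: has_field_derivative_def ehess_bilinear(3)[OF d2] mult_commute_abs)
  qed
  then obtain t where "\<phi> 1 - \<phi> 0 = (1 - 0) * ehess f (X + t *\<^sub>R \<Delta>) \<Delta> W"
    using MVT2[of 0 1 \<phi> "\<lambda>t. ehess f (X + t *\<^sub>R \<Delta>) \<Delta> W"] by auto
  then have "(egrad f (Y ** transpose Y) - egrad f X) \<bullet> W = ehess f (X + t *\<^sub>R \<Delta>) \<Delta> W"
    by (simp add: \<phi>_def \<Delta>_def inner_diff_left)
  moreover have "\<bar>ehess f (X + t *\<^sub>R \<Delta>) \<Delta> W - \<Delta> \<bullet> W\<bar> \<le> \<delta> * norm \<Delta> * norm W"
    by (rule restricted_ehess_near_inner[OF C2 restr delta rk rkD W])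
  moreover have "\<bar>\<Delta> \<bullet> W\<bar> \<le> norm \<Delta> * norm W" by (rule Cauchy_Schwarz_ineq2)
  ultimately have "\<bar>(egrad f (Y ** transpose Y) - egrad f X) \<bullet> W\<bar> \<le> \<delta> * norm \<Delta> * norm W + norm \<Delta> * norm W"
    by linarith
  then show ?thesis by (simp add: X_def \<Delta>_def algebra_simps)
qed

text \<open>With \<open>Y = Z + E\<close>, the two cross terms cost only the operator bound
  \<open>a\<close> of \<open>Z\<close>, not its Frobenius norm.\<close>

lemma norm_gram_diff_le:
  fixes Y Z :: "real^'r^'p"
  assumes upper: "\<And>x. norm (Z *v x) \<le> a * norm x" and a: "0 \<le> a"
    and YZ: "norm (Y - Z) \<le> \<rho>"
  shows "norm (Y ** transpose Y - Z ** transpose Z) \<le> 2 * a * \<rho> + \<rho>\<^sup>2"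
proof -
  define E where "E = Y - Z"
  have rho: "0 \<le> \<rho>" using YZ norm_ge_zero order_trans by blast
  have "norm (Z ** transpose E) \<le> a * norm (transpose E)"
    by (rule norm_matrix_mult_le_op[OF upper a])
  also have "\<dots> \<le> a * \<rho>" using YZ a by (intro mult_left_mono) (auto simp: E_def norm_transpose)
  finally have 1: "norm (Z ** transpose E) \<le> a * \<rho>" .
  have 2: "norm (E ** transpose Z) \<le> a * \<rho>"
    using 1 norm_transpose[of "Z ** transpose E"] by (simp add: matrix_transpose_mul)
  have "norm (E ** transpose E) \<le> norm E * norm (transpose E)" by (rule norm_matrix_mult_le)
  also have "\<dots> \<le> \<rho> * \<rho>" using YZ rho by (intro mult_mono) (auto simp: E_def norm_transpose)
  finally have 3: "norm (E ** transpose E) \<le> \<rho> * \<rho>" .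
  have "Y ** transpose Y - Z ** transpose Z = Z ** transpose E + E ** transpose Z + E ** transpose E"
    by (simp add: E_def matrix_linear_simps)
  then have "norm (Y ** transpose Y - Z ** transpose Z)
      \<le> norm (Z ** transpose E) + norm (E ** transpose Z) + norm (E ** transpose E)"
    using norm_triangle_le norm_triangle_ineq by (metis add_mono order_refl)
  then show ?thesis using 1 2 3 by (simp add: power2_eq_square)
qed

text \<open>For horizontal \<open>\<theta>\<close> the cross term of the square is
  \<open>(norm (Y\<^sup>T \<theta>))\<^sup>2\<close>, hence nonnegative. In vertical directions the
  sum would vanish, so this is where horizontality gives coercivity.\<close>

lemma norm_gram_derivative:
  fixes Y \<theta> :: "real^'r^'p"
  assumes hor: "\<theta> \<in> horizontal Y"
  shows "2 * (norm (Y ** transpose \<theta>))\<^sup>2 \<le> (norm (Y ** transpose \<theta> + \<theta> ** transpose Y))\<^sup>2"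
    and "(norm (Y ** transpose \<theta> + \<theta> ** transpose Y))\<^sup>2 \<le> 4 * (norm (Y ** transpose \<theta>))\<^sup>2"
proof -
  define W where "W = transpose Y ** \<theta>"
  have W: "transpose \<theta> ** Y = W"
    using hor by (simp add: W_def horizontal_def matrix_transpose_mul)
  define w where "w = (Y ** transpose \<theta>) \<bullet> (\<theta> ** transpose Y)"
  have "w = transpose \<theta> \<bullet> (W ** transpose Y)"
    by (simp add: w_def W_def inner_mult_right matrix_mul_assoc)
  also have "\<dots> = (W ** transpose Y) \<bullet> transpose \<theta>" by (rule inner_commute)
  also have "\<dots> = W \<bullet> W" by (simp add: inner_mult_left W)
  finally have w0: "0 \<le> w" by simp
  have n: "norm (\<theta> ** transpose Y) = norm (Y ** transpose \<theta>)"
    using norm_transpose[of "Y ** transpose \<theta>"] by (simp add: matrix_transpose_mul)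
  have "w \<le> norm (Y ** transpose \<theta>) * norm (\<theta> ** transpose Y)"
    unfolding w_def by (rule norm_cauchy_schwarz)
  then have w1: "w \<le> (norm (Y ** transpose \<theta>))\<^sup>2" by (simp add: n power2_eq_square)
  have "(norm (Y ** transpose \<theta> + \<theta> ** transpose Y))\<^sup>2
      = (norm (Y ** transpose \<theta>))\<^sup>2 + (norm (\<theta> ** transpose Y))\<^sup>2 + 2 * w"
    by (simp add: power2_norm_eq_inner inner_add_left inner_add_right w_def inner_commute)
  then have "(norm (Y ** transpose \<theta> + \<theta> ** transpose Y))\<^sup>2 = 2 * (norm (Y ** transpose \<theta>))\<^sup>2 + 2 * w"
    by (simp add: n)
  then show "2 * (norm (Y ** transpose \<theta>))\<^sup>2 \<le> (norm (Y ** transpose \<theta> + \<theta> ** transpose Y))\<^sup>2"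
    "(norm (Y ** transpose \<theta> + \<theta> ** transpose Y))\<^sup>2 \<le> 4 * (norm (Y ** transpose \<theta>))\<^sup>2"
    using w0 w1 by linarith+
qed

lemma hess_form_bounds:
  fixes f :: "real^'p^'p \<Rightarrow> real" and Y Z \<theta> :: "real^'r^'p"
  assumes C2: "twice_cont_diff f" and sym: "\<And>X. f X = f (transpose X)"
    and delta: "0 \<le> \<delta>"
    and restr: "restricted_convex_smooth (2 * CARD('r)) (4 * CARD('r)) \<delta> f"
    and upper: "\<And>x. norm (Z *v x) \<le> a * norm x" and lower: "\<And>x. b * norm x \<le> norm (Z *v x)"
    and a: "0 \<le> a" and rho: "\<rho> \<le> b" and YZ: "norm (Y - Z) \<le> \<rho>"
    and best: "best_rank_approx CARD('r) (egrad f (Z ** transpose Z)) G"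
    and hor: "\<theta> \<in> horizontal Y"
  shows "(2 * (b - \<rho>)\<^sup>2 - 4 * \<delta> * (a + \<rho>)\<^sup>2 - 2 * (1 + \<delta>) * (2 * a * \<rho> + \<rho>\<^sup>2) - 2 * norm G)
        * (norm \<theta>)\<^sup>2 \<le> hess_form (quot_fun f) Y \<theta>"
    and "hess_form (quot_fun f) Y \<theta> \<le>
      (4 * (1 + \<delta>) * (a + \<rho>)\<^sup>2 + 2 * (1 + \<delta>) * (2 * a * \<rho> + \<rho>\<^sup>2) + 2 * norm G) * (norm \<theta>)\<^sup>2"
proof -
  define S where "S = Y ** transpose \<theta> + \<theta> ** transpose Y"
  define W where "W = \<theta> ** transpose \<theta>"
  define n where "n = (norm (Y ** transpose \<theta>))\<^sup>2"
  define \<tau> where "\<tau> = (norm \<theta>)\<^sup>2"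
  define H where "H = ehess f (Y ** transpose Y) S S"
  define E where "E = (egrad f (Y ** transpose Y) - egrad f (Z ** transpose Z)) \<bullet> W"
  define F where "F = egrad f (Z ** transpose Z) \<bullet> W"
  have rho0: "0 \<le> \<rho>" using YZ norm_ge_zero order_trans by blast
  have form: "hess_form (quot_fun f) Y \<theta> = H + 2 * E + 2 * F"
    by (simp add: hess_form_quot_fun[OF C2 sym hor] H_def S_def E_def F_def W_def inner_diff_left)
  have "norm W \<le> norm \<theta> * norm (transpose \<theta>)" unfolding W_def by (rule norm_matrix_mult_le)
  then have W: "norm W \<le> \<tau>" by (simp add: \<tau>_def norm_transpose power2_eq_square)
  have rkW: "rank W \<le> CARD('r)" unfolding W_def by (rule rank_gram_le)
  have "\<bar>F\<bar> \<le> norm G * norm W" unfolding F_def by (rule best_rank_approx_inner_le[OF best rkW])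
  also have "\<dots> \<le> norm G * \<tau>" using W by (rule mult_left_mono) simp
  finally have F: "\<bar>F\<bar> \<le> norm G * \<tau>" .
  have "\<bar>E\<bar> \<le> (1 + \<delta>) * norm (Y ** transpose Y - Z ** transpose Z) * norm W"
    unfolding E_def using rkW by (intro egrad_gram_diff_inner_le[OF C2 delta restr]) simp
  also have "\<dots> \<le> (1 + \<delta>) * (2 * a * \<rho> + \<rho>\<^sup>2) * \<tau>"
    using norm_gram_diff_le[OF upper a YZ] delta W a rho0
    by (intro mult_mono mult_nonneg_nonneg add_nonneg_nonneg) auto
  finally have E: "\<bar>E\<bar> \<le> (1 + \<delta>) * (2 * a * \<rho> + \<rho>\<^sup>2) * \<tau>" .
  have "rank S \<le> 4 * CARD('r)"
    unfolding S_def using rank_add_le[of "Y ** transpose \<theta>" "\<theta> ** transpose Y"]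
      rank_gram_le[of Y \<theta>] rank_gram_le[of \<theta> Y] by linarith
  moreover have "rank (Y ** transpose Y) \<le> 2 * CARD('r)" using rank_gram_le[of Y Y] by linarith
  ultimately have H: "(1 - \<delta>) * (norm S)\<^sup>2 \<le> H" "H \<le> (1 + \<delta>) * (norm S)\<^sup>2"
    using restr by (simp_all add: restricted_convex_smooth_def H_def)
  have S: "2 * n \<le> (norm S)\<^sup>2" "(norm S)\<^sup>2 \<le> 4 * n"
    unfolding n_def S_def by (rule norm_gram_derivative[OF hor])+
  have "(b - \<rho>) * norm (transpose \<theta>) \<le> norm (Y ** transpose \<theta>)"
    using bounds_perturb(2)[OF YZ lower] rho by (intro norm_matrix_mult_ge_op) auto
  then have "((b - \<rho>) * norm \<theta>)\<^sup>2 \<le> n"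
    unfolding n_def using rho by (intro power_mono) (auto simp: norm_transpose)
  then have n1: "(b - \<rho>)\<^sup>2 * \<tau> \<le> n" by (simp add: \<tau>_def power_mult_distrib)
  have "norm (Y ** transpose \<theta>) \<le> (a + \<rho>) * norm (transpose \<theta>)"
    using bounds_perturb(1)[OF YZ upper] a rho0 by (intro norm_matrix_mult_le_op) auto
  then have "n \<le> ((a + \<rho>) * norm \<theta>)\<^sup>2"
    unfolding n_def by (intro power_mono) (auto simp: norm_transpose)
  then have n2: "n \<le> (a + \<rho>)\<^sup>2 * \<tau>" by (simp add: \<tau>_def power_mult_distrib)
  \<comment> \<open>In \<open>(1 - \<delta>) * (norm S)\<^sup>2\<close> the two parts are bounded
    separately, the subtracted one by the upper bound. This is why
    \<open>4 * \<delta> * (a + \<rho>)\<^sup>2\<close> also appears in the lower Hessian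
    bound.\<close>
  have dS: "\<delta> * (norm S)\<^sup>2 \<le> 4 * \<delta> * ((a + \<rho>)\<^sup>2 * \<tau>)"
    using mult_left_mono[of "(norm S)\<^sup>2" "4 * ((a + \<rho>)\<^sup>2 * \<tau>)" \<delta>] S n2 delta by simp
  have "2 * ((b - \<rho>)\<^sup>2 * \<tau>) - 4 * \<delta> * ((a + \<rho>)\<^sup>2 * \<tau>) \<le> H"
    using H(1) S(1) n1 dS by (simp add: left_diff_distrib)
  then show "(2 * (b - \<rho>)\<^sup>2 - 4 * \<delta> * (a + \<rho>)\<^sup>2 - 2 * (1 + \<delta>) * (2 * a * \<rho> + \<rho>\<^sup>2) - 2 * norm G)
        * (norm \<theta>)\<^sup>2 \<le> hess_form (quot_fun f) Y \<theta>"
    using E F unfolding form \<tau>_def[symmetric] left_diff_distrib mult.assoc by linarith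
  have "H \<le> 4 * ((a + \<rho>)\<^sup>2 * \<tau>) + 4 * \<delta> * ((a + \<rho>)\<^sup>2 * \<tau>)"
    using H(2) S(2) n2 dS by (simp add: distrib_right)
  then show "hess_form (quot_fun f) Y \<theta> \<le>
      (4 * (1 + \<delta>) * (a + \<rho>)\<^sup>2 + 2 * (1 + \<delta>) * (2 * a * \<rho> + \<rho>\<^sup>2) + 2 * norm G) * (norm \<theta>)\<^sup>2"
    using E F unfolding form \<tau>_def[symmetric]
    by (simp add: distrib_right distrib_left mult.assoc)
qed

section \<open>The function and its gradient along horizontal lines\<close>

lemma DERIV_quot_fun_line:
  fixes f :: "real^'p^'p \<Rightarrow> real" and Y \<theta> :: "real^'r^'p"
  assumes d: "\<And>x. f differentiable (at x)"
  shows "((\<lambda>t. quot_fun f (cls (Y + t *\<^sub>R \<theta>))) has_real_derivative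
      grad_lift (quot_fun f) (Y + t *\<^sub>R \<theta>) \<bullet> \<theta>) (at t)"
proof -
  have "(\<lambda>Y. quot_fun f (cls Y)) differentiable (at Y)" for Y :: "real^'r^'p"
    unfolding quot_fun_cls
    using has_derivative_compose[OF has_derivative_gram egrad_works[OF d, unfolded gderiv_def]]
    by (auto simp: differentiable_def)
  from DERIV_egrad_line[OF this] show ?thesis by (simp only: grad_lift_def)
qed

lemma DERIV_grad_lift_line:
  fixes f :: "real^'p^'p \<Rightarrow> real" and Y \<theta> :: "real^'r^'p"
  assumes C2: "twice_cont_diff f" and sym: "\<And>X. f X = f (transpose X)"
    and hor: "\<theta> \<in> horizontal Y"
  shows "((\<lambda>t. grad_lift (quot_fun f) (Y + t *\<^sub>R \<theta>) \<bullet> \<theta>) has_real_derivative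
      hess_form (quot_fun f) (Y + t *\<^sub>R \<theta>) \<theta>) (at t)"
proof -
  define g where "g = grad_lift (quot_fun f :: (real^'r^'p) set \<Rightarrow> real)"
  have d: "\<And>x. f differentiable (at x)" and d2: "\<And>x. egrad f differentiable (at x)"
    using C2 by (auto simp: twice_cont_diff_def)
  define c where "c = Y + t *\<^sub>R \<theta>"
  have g_eq: "g = (\<lambda>Y. 2 *\<^sub>R (egrad f (Y ** transpose Y) ** Y))"
    unfolding g_def using grad_lift_quot_fun[OF d sym] by auto
  have "(g has_derivative
      (\<lambda>h. 2 *\<^sub>R (egrad f (c ** transpose c) ** h
        + frechet_derivative (egrad f) (at (c ** transpose c)) (c ** transpose h + h ** transpose c) ** c)))
      (at c)"
    unfolding g_eq by (intro has_derivative_scaleR_right bounded_bilinear.FDERIV[OF bounded_bilinear_matrix_mult]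
        has_derivative_ident has_derivative_compose[OF has_derivative_gram ehess_works[OF d2]])
  then have "g differentiable (at c)" by (rule differentiableI)
  then have g: "(g has_derivative frechet_derivative g (at c)) (at c)"
    by (rule frechet_derivative_works[THEN iffD1])
  have "((\<lambda>t. Y + t *\<^sub>R \<theta>) has_derivative (\<lambda>h. h *\<^sub>R \<theta>)) (at t)"
    by (auto intro!: derivative_eq_intros)
  from has_derivative_inner_left[OF has_derivative_compose[OF this g[unfolded c_def]], of \<theta>]
  have "((\<lambda>t. g (Y + t *\<^sub>R \<theta>) \<bullet> \<theta>) has_derivative
      (\<lambda>h. frechet_derivative g (at c) (h *\<^sub>R \<theta>) \<bullet> \<theta>)) (at t)"
    by (simp add: c_def)
  \<comment> \<open>The velocity remains horizontal along the line, so pairing with it does not see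
    the projection in \<open>hess_lift\<close>.\<close>
  moreover have "frechet_derivative g (at c) (h *\<^sub>R \<theta>) \<bullet> \<theta> = hess_form (quot_fun f) c \<theta> * h" for h
    using linear_cmul[OF has_derivative_linear[OF g], of h \<theta>]
      inner_hproj[OF horizontal_line[OF hor, of t]]
    by (simp add: hess_form_def hess_lift_def g_def c_def mult.commute)
  ultimately show ?thesis by (simp add: has_field_derivative_def g_def c_def)
qed

lemma grad_lift_line_ge:
  fixes f :: "real^'p^'p \<Rightarrow> real" and Y \<theta> :: "real^'r^'p"
  assumes C2: "twice_cont_diff f" and sym: "\<And>X. f X = f (transpose X)"
    and hor: "\<theta> \<in> horizontal Y"
    and m: "\<And>t. t \<in> {0..1} \<Longrightarrow> m \<le> hess_form (quot_fun f) (Y + t *\<^sub>R \<theta>) \<theta>"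
    and t: "t \<in> {0..1}"
  shows "grad_lift (quot_fun f) Y \<bullet> \<theta> + t * m \<le> grad_lift (quot_fun f) (Y + t *\<^sub>R \<theta>) \<bullet> \<theta>"
proof (cases "t = 0")
  case False
  define \<phi> where "\<phi> t = grad_lift (quot_fun f) (Y + t *\<^sub>R \<theta>) \<bullet> \<theta>" for t
  have "(\<phi> has_real_derivative hess_form (quot_fun f) (Y + s *\<^sub>R \<theta>) \<theta>) (at s)" for s
    unfolding \<phi>_def by (rule DERIV_grad_lift_line[OF C2 sym hor])
  then obtain s where s: "0 < s" "s < t" "\<phi> t - \<phi> 0 = (t - 0) * hess_form (quot_fun f) (Y + s *\<^sub>R \<theta>) \<theta>"
    using MVT2[of 0 t \<phi> "\<lambda>s. hess_form (quot_fun f) (Y + s *\<^sub>R \<theta>) \<theta>"] t False by auto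
  have "t * m \<le> t * hess_form (quot_fun f) (Y + s *\<^sub>R \<theta>) \<theta>"
    using m[of s] s t by (intro mult_left_mono) auto
  then show ?thesis using s(3) by (simp add: \<phi>_def)
qed simp

lemma quot_fun_line_less:
  fixes f :: "real^'p^'p \<Rightarrow> real" and Y \<theta> :: "real^'r^'p"
  assumes d: "\<And>x. f differentiable (at x)"
    and st: "s < t"
  obtains u where "s < u" "u < t"
    "quot_fun f (cls (Y + t *\<^sub>R \<theta>)) - quot_fun f (cls (Y + s *\<^sub>R \<theta>))
      = (t - s) * (grad_lift (quot_fun f) (Y + u *\<^sub>R \<theta>) \<bullet> \<theta>)"
  using MVT2[OF st, of "\<lambda>t. quot_fun f (cls (Y + t *\<^sub>R \<theta>))"
      "\<lambda>t. grad_lift (quot_fun f) (Y + t *\<^sub>R \<theta>) \<bullet> \<theta>"] DERIV_quot_fun_line[OF d]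
  by blast

text \<open>Nonnegativity of the Hessian is assumed on a full neighbourhood of \<open>Y\<close>, so
  the resulting minimality holds on the whole quotient and not only inside a ball around
  \<open>[Ys]\<close>.\<close>

lemma stationary_le_near:
  fixes f :: "real^'p^'p \<Rightarrow> real" and Y Z :: "real^'r^'p"
  assumes C2: "twice_cont_diff f" and sym: "\<And>X. f X = f (transpose X)"
    and stat: "grad_lift (quot_fun f) Y = 0"
    and psd: "\<And>W \<theta>. norm (W - Y) < \<epsilon> \<Longrightarrow> \<theta> \<in> horizontal W \<Longrightarrow> 0 \<le> hess_form (quot_fun f) W \<theta>"
    and Z: "qdist Y Z < \<epsilon>"
  shows "quot_fun f (cls Y) \<le> quot_fun f (cls Z)"
proof -
  obtain Q where Q: "orthogonal_matrix Q" "qdist Y Z = norm (Z ** Q - Y)"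
    "transpose (transpose (Z ** Q) ** Y) = transpose (Z ** Q) ** Y"
    by (rule qdist_aligned)
  define \<theta> where "\<theta> = Z ** Q - Y"
  have hor: "\<theta> \<in> horizontal Y" unfolding \<theta>_def by (rule horizontal_diff[OF Q(3)])
  have d: "\<And>x. f differentiable (at x)" using C2 by (simp add: twice_cont_diff_def)
  have pos: "0 \<le> hess_form (quot_fun f) (Y + t *\<^sub>R \<theta>) \<theta>" if "t \<in> {0..1}" for t
  proof (rule psd[OF _ horizontal_line[OF hor]])
    have "\<bar>t\<bar> * norm \<theta> \<le> norm \<theta>" using that by (simp add: mult_left_le_one_le)
    then show "norm (Y + t *\<^sub>R \<theta> - Y) < \<epsilon>" using Q(2) Z by (simp add: \<theta>_def)
  qed
  obtain u where u: "0 < u" "u < 1" "quot_fun f (cls (Y + 1 *\<^sub>R \<theta>)) - quot_fun f (cls (Y + 0 *\<^sub>R \<theta>))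
      = (1 - 0) * (grad_lift (quot_fun f) (Y + u *\<^sub>R \<theta>) \<bullet> \<theta>)"
    using quot_fun_line_less[OF d, of 0 1 Y \<theta>] zero_less_one by blast
  have "0 \<le> grad_lift (quot_fun f) (Y + u *\<^sub>R \<theta>) \<bullet> \<theta>"
    using grad_lift_line_ge[OF C2 sym hor pos, of u] u stat by simp
  then show ?thesis using u(3) cls_mult[OF Q(1), of Z] by (simp add: \<theta>_def)
qed

section \<open>Singular values of a factor with diagonal Gram matrix\<close>

lemma diag_mat_vector: "diag_mat s *v x = (\<chi> i. s $ i * x $ i)"
  by (simp add: diag_mat_def matrix_vector_mult_def vec_eq_iff if_distrib[of "\<lambda>y. y * _"]
      cong: if_cong)

lemma diag_mat_mult: "diag_mat s ** diag_mat t = diag_mat (\<chi> i. s $ i * t $ i)"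
proof -
  have "(diag_mat s ** diag_mat t) *v x = diag_mat (\<chi> i. s $ i * t $ i) *v x" for x
    by (simp add: matrix_vector_mul_assoc[symmetric] diag_mat_vector ac_simps)
  then show ?thesis by (simp add: matrix_eq)
qed

lemma transpose_diag_mat: "transpose (diag_mat s) = diag_mat s"
  by (auto simp: transpose_def diag_mat_def vec_eq_iff)

lemma proots_charpoly_diag_mat:
  "proots (charpoly (diag_mat s)) = image_mset (($) s) (mset_set UNIV)"
proof -
  have "charpoly (diag_mat s) = (\<Prod>i\<in>UNIV. [:- (s $ i), 1:])"
    unfolding charpoly_def by (subst det_diagonal) (auto simp: diag_mat_def)
  also have "proots \<dots> = (\<Sum>i\<in>UNIV. {#s $ i#})"
    by (subst proots_prod) auto
  also have "\<dots> = image_mset (($) s) (mset_set UNIV)"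
    by (induction rule: finite_induct[OF finite]) auto
  finally show ?thesis .
qed

text \<open>The characteristic polynomial of a diagonal matrix splits visibly, so the list-based
  singular values become square roots of diagonal entries. From here on they are used through vector
  inequalities.\<close>

lemma sing_val_gram_diag_mat:
  fixes Y :: "real^'r^'p"
  assumes gram: "transpose Y ** Y = diag_mat s" and pos: "\<And>i. 0 < s $ i"
  shows "0 < sing_val CARD('r) Y"
    and "sing_val CARD('r) Y \<le> sing_val 1 Y"
    and "sing_val CARD('r) Y * norm x \<le> norm (Y *v x)"
    and "norm (Y *v x) \<le> sing_val 1 Y * norm x"
proof -
  define xs where "xs = sorted_list_of_multiset (image_mset (($) s) (mset_set (UNIV :: 'r set)))"
  have srt: "sorted xs" by (simp add: xs_def)
  have mset: "mset xs = image_mset (($) s) (mset_set UNIV)" by (simp add: xs_def)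
  then have set: "set xs = range (($) s)" by (metis finite finite_set_mset_mset_set set_image_mset set_mset_mset)
  have len: "length xs = CARD('r)" using arg_cong[OF mset, of size] by simp
  then have ne: "0 < length xs" by simp
  have sv: "singular_values Y = map sqrt (rev xs)"
    by (simp add: singular_values_def gram proots_charpoly_diag_mat xs_def)
  \<comment> \<open>\<open>xs\<close> is increasing and \<open>singular_values\<close> reverses it,
    so index 1 reads the last entry and index \<open>CARD('r)\<close> the entry at position
    0.\<close>
  have s1: "sing_val 1 Y = sqrt (xs ! (length xs - 1))" and sr: "sing_val CARD('r) Y = sqrt (xs ! 0)"
    using ne by (simp_all add: sing_val_def sv rev_nth len)
  have bnd: "xs ! 0 \<le> s $ i" "s $ i \<le> xs ! (length xs - 1)" for i
  proof -
    obtain k where "k < length xs" "xs ! k = s $ i" using set by (metis in_set_conv_nth rangeI)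
    then show "xs ! 0 \<le> s $ i" "s $ i \<le> xs ! (length xs - 1)"
      using sorted_nth_mono[OF srt, of 0 k] sorted_nth_mono[OF srt, of k "length xs - 1"] by auto
  qed
  have "xs ! 0 \<in> range (($) s)" using set nth_mem[OF ne] by simp
  then have p0: "0 < xs ! 0" using pos by auto
  then show "0 < sing_val CARD('r) Y" by (simp add: sr)
  show "sing_val CARD('r) Y \<le> sing_val 1 Y"
    unfolding sr s1 using bnd by (meson order_trans real_sqrt_le_mono)
  have p1: "0 < xs ! (length xs - 1)" using p0 bnd by (meson order_less_le_trans)
  have "(norm (Y *v x))\<^sup>2 = x \<bullet> ((transpose Y ** Y) *v x)"
    unfolding power2_norm_eq_inner
    by (metis dot_lmul_matrix matrix_vector_mul_assoc transpose_matrix_vector inner_commute)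
  then have n: "(norm (Y *v x))\<^sup>2 = (\<Sum>i\<in>UNIV. s $ i * (x $ i)\<^sup>2)"
    by (simp add: gram diag_mat_vector inner_vec_def power2_eq_square ac_simps)
  have nx: "(norm x)\<^sup>2 = (\<Sum>i\<in>UNIV. (x $ i)\<^sup>2)"
    unfolding power2_norm_eq_inner by (simp add: inner_vec_def power2_eq_square)
  show "sing_val CARD('r) Y * norm x \<le> norm (Y *v x)"
  proof (rule power2_le_imp_le)
    show "(sing_val CARD('r) Y * norm x)\<^sup>2 \<le> (norm (Y *v x))\<^sup>2"
      using p0 unfolding sr n power_mult_distrib nx sum_distrib_left
      by (intro sum_mono mult_right_mono) (use bnd in auto)
  qed simp
  show "norm (Y *v x) \<le> sing_val 1 Y * norm x"
  proof (rule power2_le_imp_le)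
    show "(norm (Y *v x))\<^sup>2 \<le> (sing_val 1 Y * norm x)\<^sup>2"
      using p1 unfolding s1 n power_mult_distrib nx sum_distrib_left
      by (intro sum_mono mult_right_mono) (use bnd in auto)
    show "0 \<le> sing_val 1 Y * norm x" using p1 unfolding s1 by simp
  qed
qed

lemma reduced_eigendecomp_factor:
  fixes X :: "real^'p^'p" and U Y :: "real^'r^'p"
  assumes psd: "pos_semidef X" and eig: "reduced_eigendecomp X U s"
    and Y: "Y = U ** diag_mat (\<chi> i. sqrt (s $ i))"
  shows "0 < s $ i" and "transpose Y ** Y = diag_mat s" and "Y ** transpose Y = X"
proof -
  have U: "transpose U ** U = mat 1" and s0: "\<And>i. s $ i \<noteq> 0"
    and X: "X = U ** diag_mat s ** transpose U"
    using eig by (auto simp: reduced_eigendecomp_def)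
  have pos: "0 < s $ i" for i
  proof -
    \<comment> \<open>The eigenvector for \<open>s $ i\<close>: semidefiniteness tested on it gives
      the sign, and a reduced decomposition has no zero entries.\<close>
    define x where "x = U *v axis i 1"
    have tx: "transpose U *v x = axis i 1"
      unfolding x_def by (metis U matrix_vector_mul_assoc matrix_vector_mul_lid)
    have "x \<bullet> (X *v x) = x \<bullet> (U *v (diag_mat s *v (transpose U *v x)))"
      by (simp only: X matrix_vector_mul_assoc matrix_mul_assoc)
    also have "\<dots> = (transpose U *v x) \<bullet> (diag_mat s *v (transpose U *v x))"
      by (metis dot_lmul_matrix transpose_matrix_vector)
    also have "\<dots> = s $ i" unfolding tx by (simp add: diag_mat_vector inner_axis')
    finally have "0 \<le> s $ i" using psd by (metis pos_semidef_def)
    then show ?thesis using s0[of i] by simp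
  qed
  then show "0 < s $ i" .
  have "transpose Y ** Y = diag_mat (\<chi> i. sqrt (s $ i)) ** (transpose U ** U) ** diag_mat (\<chi> i. sqrt (s $ i))"
    by (simp add: Y matrix_transpose_mul transpose_diag_mat matrix_mul_assoc)
  then show "transpose Y ** Y = diag_mat s" by (simp add: U diag_mat_mult abs_of_pos[OF pos])
  have "Y ** transpose Y = U ** (diag_mat (\<chi> i. sqrt (s $ i)) ** diag_mat (\<chi> i. sqrt (s $ i))) ** transpose U"
    by (simp add: Y matrix_transpose_mul transpose_diag_mat matrix_mul_assoc)
  then show "Y ** transpose Y = X" by (simp add: X diag_mat_mult abs_of_pos[OF pos])
qed

section \<open>Extremal values of the Hessian, straight geodesics, and the spectral-norm gradient
  bound\<close>

lemma hess_lmin_lmax_bounds: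
  fixes Y :: "real^'r^'p"
  assumes "Y \<noteq> 0"
  shows "(\<And>\<theta>. \<theta> \<in> horizontal Y \<Longrightarrow> m * (norm \<theta>)\<^sup>2 \<le> hess_form h Y \<theta>) \<Longrightarrow> m \<le> hess_lmin h Y"
    and "(\<And>\<theta>. \<theta> \<in> horizontal Y \<Longrightarrow> hess_form h Y \<theta> \<le> L * (norm \<theta>)\<^sup>2) \<Longrightarrow> hess_lmax h Y \<le> L"
proof -
  \<comment> \<open>\<open>Y\<close> itself supplies a unit horizontal vector; infimum and supremum
    need a nonempty set.\<close>
  have "Y \<in> horizontal Y" by (simp add: horizontal_def matrix_transpose_mul)
  then have "Y /\<^sub>R norm Y \<in> horizontal Y" by (intro subspace_mul subspace_horizontal)
  then have ne: "{\<theta> \<in> horizontal Y. norm \<theta> = 1} \<noteq> {}" using assms by (auto intro!: exI[of _ "Y /\<^sub>R norm Y"])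
  show "m \<le> hess_lmin h Y" if "\<And>\<theta>. \<theta> \<in> horizontal Y \<Longrightarrow> m * (norm \<theta>)\<^sup>2 \<le> hess_form h Y \<theta>"
    unfolding hess_lmin_def using that by (intro cINF_greatest[OF ne]) fastforce
  show "hess_lmax h Y \<le> L" if "\<And>\<theta>. \<theta> \<in> horizontal Y \<Longrightarrow> hess_form h Y \<theta> \<le> L * (norm \<theta>)\<^sup>2"
    unfolding hess_lmax_def using that by (intro cSUP_least[OF ne]) fastforce
qed

lemma geodesic_line:
  fixes Y \<theta> :: "real^'r^'p"
  assumes hor: "\<theta> \<in> horizontal Y" and fr: "\<And>t. t \<in> {0..1} \<Longrightarrow> Y + t *\<^sub>R \<theta> \<in> full_rank"
  shows "geodesic (\<lambda>t. cls (Y + t *\<^sub>R \<theta>))"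
  unfolding geodesic_def
proof (intro exI ballI conjI)
  fix t :: real assume t: "t \<in> {0..1}"
  show "Y + t *\<^sub>R \<theta> \<in> full_rank" by (rule fr[OF t])
  show "((\<lambda>t. Y + t *\<^sub>R \<theta>) has_vector_derivative \<theta>) (at t within {0..1})"
    by (auto intro!: derivative_eq_intros simp: has_vector_derivative_def)
  show "\<theta> \<in> horizontal (Y + t *\<^sub>R \<theta>)" by (rule horizontal_line[OF hor])
  show "((\<lambda>t. \<theta>) has_vector_derivative 0) (at t within {0..1})" by simp
  show "hproj (Y + t *\<^sub>R \<theta>) 0 = 0"
    unfolding hproj_def by (rule closest_point_self) (rule subspace_0[OF subspace_horizontal])
qed simp

text \<open>\<open>(norm (A ** Y))\<^sup>2\<close> is the pairing of \<open>A\<close> with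
  \<open>A ** Y ** transpose Y\<close>, whose rank is at most \<open>CARD('r)\<close>, so
  \<open>norm G\<close> controls it; one factor \<open>norm (A ** Y)\<close> then cancels.\<close>

lemma norm_grad_mult_le:
  fixes A :: "real^'p^'p" and Y :: "real^'r^'p"
  assumes best: "best_rank_approx CARD('r) A G"
  shows "norm (A ** Y) \<le> spectral_norm Y * norm G"
proof -
  define n where "n = norm (A ** Y)"
  have bl: "bounded_linear ((*v) Y)" by simp
  have "n * n = A \<bullet> ((A ** Y) ** transpose Y)"
    unfolding n_def by (simp add: inner_mult_left[symmetric] power2_norm_eq_inner[symmetric] power2_eq_square)
  also have "\<dots> \<le> norm G * norm ((A ** Y) ** transpose Y)"
    using best_rank_approx_inner_le[OF best rank_gram_le, of "A ** Y" Y] by linarith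
  also have "norm ((A ** Y) ** transpose Y) = norm (Y ** transpose (A ** Y))"
    using norm_transpose[of "Y ** transpose (A ** Y)"] by (simp add: matrix_transpose_mul)
  also have "norm G * norm (Y ** transpose (A ** Y)) \<le> norm G * (spectral_norm Y * norm (transpose (A ** Y)))"
    unfolding spectral_norm_def
    by (intro mult_left_mono norm_matrix_mult_le_op onorm[OF bl] onorm_pos_le[OF bl]) simp
  also have "\<dots> = (spectral_norm Y * norm G) * n" by (simp only: norm_transpose n_def ac_simps)
  finally have "n * n \<le> (spectral_norm Y * norm G) * n" .
  moreover have "0 \<le> spectral_norm Y * norm G"
    unfolding spectral_norm_def by (simp add: onorm_pos_le[OF bl])
  ultimately show ?thesis
    by (cases "n = 0") (auto simp: n_def)
qed

text \<open>The stationary point is claimed to be a local minimizer on the whole quotient, while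
  uniqueness is claimed among local minimizers of the restriction to the ball; each is the stronger
  reading. The bounds hold for every choice of the best approximation \<open>G\<close>.\<close>

theorem theorem3:
  fixes f :: "real^'p^'p \<Rightarrow> real"
    and Xs G :: "real^'p^'p"
    and U Ys :: "real^'r^'p"
    and S :: "real^'r"
    and \<delta> \<mu> N \<kappa> \<sigma>1 \<sigma>r \<alpha> :: real
    and h :: "(real^'r^'p) set \<Rightarrow> real"
  assumes dims: "CARD('r) \<le> CARD('p)"
    and f_C2: "twice_cont_diff f"
    and f_sym: "\<And>X. f X = f (transpose X)"
    and delta: "0 \<le> \<delta>" "\<delta> < 1"
    and restr: "restricted_convex_smooth (2 * CARD('r)) (4 * CARD('r)) \<delta> f"
    and mu: "0 \<le> \<mu>" "\<mu> \<le> 1 / 3"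
    and Xs: "pos_semidef Xs" "rank Xs = CARD('r)"
    and eig: "reduced_eigendecomp Xs U S"
    and Ys: "Ys = U ** diag_mat (\<chi> i. sqrt (S $ i))"
    and h: "h = quot_fun f"
    and G: "best_rank_approx CARD('r) (egrad f Xs) G"
    and N: "N = norm G"
    and \<sigma>1: "\<sigma>1 = sing_val 1 Ys"
    and \<sigma>r: "\<sigma>r = sing_val CARD('r) Ys"
    and \<kappa>: "\<kappa> = cond_num Ys"
    and \<alpha>: "\<alpha> = (1 - \<mu> / \<kappa>)\<^sup>2 - 7 * \<mu> / 3"
  shows
    "(\<forall>Y\<in>basin \<mu> Ys.
        hess_lmin h Y \<ge>
          (2 * (1 - \<mu> / \<kappa>)\<^sup>2 - 14 / 3 * \<mu>) * \<sigma>r\<^sup>2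
          - (4 * \<delta> * (\<sigma>1 + \<mu> * \<sigma>r / \<kappa>)\<^sup>2 + 14 / 3 * \<delta> * \<mu> * \<sigma>r\<^sup>2 + 2 * N) \<and>
        hess_lmax h Y \<le>
          4 * (\<sigma>1 + \<mu> * \<sigma>r / \<kappa>)\<^sup>2 + 14 / 3 * \<mu> * \<sigma>r\<^sup>2
          + (4 * \<delta> * (\<sigma>1 + \<mu> * \<sigma>r / \<kappa>)\<^sup>2 + 14 / 3 * \<delta> * \<mu> * \<sigma>r\<^sup>2 + 2 * N)) \<and>
     (\<mu> < (13 - sqrt 133) / 6 \<longrightarrow> \<alpha> > 0) \<and>
     (\<alpha> > 0 \<and> \<delta> \<le> \<alpha> / (4 * (2 * (\<kappa> + \<mu> / \<kappa>)\<^sup>2 + 7 * \<mu> / 3)) \<and> N \<le> \<alpha> * \<sigma>r\<^sup>2 / 4 \<longrightarrow>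
        (\<forall>Y\<in>basin \<mu> Ys. hess_lmin h Y \<ge> \<alpha> * \<sigma>r\<^sup>2) \<and> \<alpha> * \<sigma>r\<^sup>2 > 0 \<and>
        geod_strongly_convex_on (cls ` basin \<mu> Ys) h \<and>
        geod_smooth_on (cls ` basin \<mu> Ys) h \<and>
        (\<forall>Yh\<in>basin \<mu> Ys. grad_lift h Yh = 0 \<longrightarrow>
           local_minimizer_on quot_mfd h Yh \<and>
           (\<forall>Z. local_minimizer_on (cls ` basin \<mu> Ys) h Z \<longrightarrow> cls Z = cls Yh) \<and>
           qdist Yh Ys \<le> 2 * norm (egrad f (Ys ** transpose Ys) ** Ys) / (\<alpha> * \<sigma>r\<^sup>2) \<and>
           2 * norm (egrad f (Ys ** transpose Ys) ** Ys) / (\<alpha> * \<sigma>r\<^sup>2)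
             \<le> 2 * spectral_norm Ys * N / (\<alpha> * \<sigma>r\<^sup>2)))"
proof -
  define \<rho> where "\<rho> = \<mu> * \<sigma>r / \<kappa>"
  have fac: "transpose Ys ** Ys = diag_mat S" "\<And>i. 0 < S $ i" "Ys ** transpose Ys = Xs"
    using reduced_eigendecomp_factor[OF Xs(1) eig Ys] by blast+
  note sv = sing_val_gram_diag_mat[OF fac(1,2), folded \<sigma>1 \<sigma>r]
  have b0: "0 < \<sigma>r" and ab: "\<sigma>r \<le> \<sigma>1" and lower: "\<sigma>r * norm x \<le> norm (Ys *v x)"
    and upper: "norm (Ys *v x) \<le> \<sigma>1 * norm x" for x
    using sv by blast+
  have a0: "0 \<le> \<sigma>1" using b0 ab by linarith
  have k: "\<kappa> = \<sigma>1 / \<sigma>r" by (simp add: \<kappa> cond_num_def \<sigma>1 \<sigma>r)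
  have k1: "1 \<le> \<kappa>" using b0 ab by (simp add: k)
  have rho0: "0 \<le> \<rho>" using mu b0 k1 by (simp add: \<rho>_def)
  \<comment> \<open>The factor \<open>1 / \<kappa>\<close> in the radius exactly cancels the growth
    of \<open>\<sigma>1\<close>.\<close>
  have arho: "\<sigma>1 * \<rho> = \<mu> * \<sigma>r\<^sup>2"
    using b0 ab by (simp add: \<rho>_def k power2_eq_square)
  have rho_mu: "\<rho> \<le> \<mu> * \<sigma>r"
    using mult_left_mono[OF k1, of "\<mu> * \<sigma>r"] mu b0 k1 by (simp add: \<rho>_def field_simps)
  have "\<mu> * \<sigma>r \<le> 1 / 3 * \<sigma>r" using mu b0 by (intro mult_right_mono) auto
  then have rho3: "\<rho> \<le> \<sigma>r / 3" using rho_mu by simp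
  have "\<mu> * \<sigma>r\<^sup>2 \<le> 1 / 3 * \<sigma>r\<^sup>2" using mu by (intro mult_right_mono) auto
  then have arho3: "\<sigma>1 * \<rho> \<le> \<sigma>r\<^sup>2 / 3" using arho by simp
  \<comment> \<open>Origin of \<open>7/3\<close>: 2 from the cross terms and \<open>1/3\<close> from
    \<open>\<rho>\<^sup>2\<close>, using \<open>\<mu> \<le> 1/3\<close> once.\<close>
  have "\<rho>\<^sup>2 \<le> (\<mu> * \<sigma>r)\<^sup>2" using rho_mu rho0 by (rule power_mono)
  also have "\<dots> = \<mu> * (\<mu> * \<sigma>r\<^sup>2)" by (simp add: power2_eq_square)
  also have "\<dots> \<le> 1 / 3 * (\<mu> * \<sigma>r\<^sup>2)" using mu by (intro mult_right_mono) auto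
  finally have rho_sq: "2 * \<sigma>1 * \<rho> + \<rho>\<^sup>2 \<le> 7 / 3 * (\<mu> * \<sigma>r\<^sup>2)" using arho by simp
  have brho: "(\<sigma>r - \<rho>)\<^sup>2 = (1 - \<mu> / \<kappa>)\<^sup>2 * \<sigma>r\<^sup>2"
    by (simp add: \<rho>_def power_mult_distrib[symmetric] left_diff_distrib)
  have basin: "Y \<in> basin \<mu> Ys \<longleftrightarrow> Y \<in> full_rank \<and> qdist Y Ys \<le> \<rho>" for Y
    by (simp add: basin_def \<rho>_def \<sigma>r \<kappa>)
  have d: "\<And>x. f differentiable (at x)" using f_C2 by (simp add: twice_cont_diff_def)

  \<comment> \<open>The radius is kept as a variable because local minimality needs the bounds
    slightly beyond \<open>\<rho>\<close>.\<close>
  define lo where "lo x = 2 * (\<sigma>r - x)\<^sup>2 - 4 * \<delta> * (\<sigma>1 + x)\<^sup>2 - 2 * (1 + \<delta>) * (2 * \<sigma>1 * x + x\<^sup>2) - 2 * N" for x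
  define up where "up x = 4 * (1 + \<delta>) * (\<sigma>1 + x)\<^sup>2 + 2 * (1 + \<delta>) * (2 * \<sigma>1 * x + x\<^sup>2) + 2 * N" for x
  have form: "lo x * (norm \<theta>)\<^sup>2 \<le> hess_form h Y \<theta> \<and> hess_form h Y \<theta> \<le> up x * (norm \<theta>)\<^sup>2"
    if x: "qdist Y Ys \<le> x" "x \<le> \<sigma>r" and hor: "\<theta> \<in> horizontal Y" for Y \<theta> x
  proof -
    obtain Q where Q: "orthogonal_matrix Q" "qdist Y Ys = norm (Ys ** Q - Y)"
      by (rule qdist_attained)
    have YZ: "norm (Y - Ys ** Q) \<le> x" using Q(2) x by (simp add: norm_minus_commute)
    \<comment> \<open>Rotating \<open>Ys\<close> leaves its Gram matrix, hence the gradient there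
      and \<open>G\<close>, unchanged.\<close>
    have best: "best_rank_approx CARD('r) (egrad f ((Ys ** Q) ** transpose (Ys ** Q))) G"
      using G by (simp only: gram_mult_orthogonal[OF Q(1)] fac(3))
    note up' = bounds_mult_orthogonal(1)[OF Q(1) upper]
      and lo' = bounds_mult_orthogonal(2)[OF Q(1) lower]
    show ?thesis
      unfolding lo_def up_def h N
      using hess_form_bounds[OF f_C2 f_sym delta(1) restr up' lo' a0 x(2) YZ best hor] by blast
  qed
  define LB where "LB = (2 * (1 - \<mu> / \<kappa>)\<^sup>2 - 14 / 3 * \<mu>) * \<sigma>r\<^sup>2
    - (4 * \<delta> * (\<sigma>1 + \<rho>)\<^sup>2 + 14 / 3 * \<delta> * \<mu> * \<sigma>r\<^sup>2 + 2 * N)"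
  define UB where "UB = 4 * (\<sigma>1 + \<rho>)\<^sup>2 + 14 / 3 * \<mu> * \<sigma>r\<^sup>2
    + (4 * \<delta> * (\<sigma>1 + \<rho>)\<^sup>2 + 14 / 3 * \<delta> * \<mu> * \<sigma>r\<^sup>2 + 2 * N)"
  have "2 * (1 + \<delta>) * (2 * \<sigma>1 * \<rho> + \<rho>\<^sup>2) \<le> 2 * (1 + \<delta>) * (7 / 3 * (\<mu> * \<sigma>r\<^sup>2))"
    using rho_sq delta by (intro mult_left_mono) auto
  then have LB: "LB \<le> lo \<rho>" and UB: "up \<rho> \<le> UB"
    unfolding lo_def up_def LB_def UB_def brho by (simp_all add: algebra_simps)
  have rho_r: "\<rho> \<le> \<sigma>r" using rho3 b0 by simp
  have nz: "Y \<noteq> 0" if "Y \<in> full_rank" for Y :: "real^'r^'p"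
    using that by (auto simp: full_rank_def)
  have formB: "LB * (norm \<theta>)\<^sup>2 \<le> hess_form h Y \<theta>" "hess_form h Y \<theta> \<le> UB * (norm \<theta>)\<^sup>2"
    if "qdist Y Ys \<le> \<rho>" "\<theta> \<in> horizontal Y" for Y \<theta>
    using form[OF that(1) rho_r that(2)] mult_right_mono[OF LB, of "(norm \<theta>)\<^sup>2"]
      mult_right_mono[OF UB, of "(norm \<theta>)\<^sup>2"] by auto

  have part1: "\<forall>Y\<in>basin \<mu> Ys. LB \<le> hess_lmin h Y \<and> hess_lmax h Y \<le> UB"
    using hess_lmin_lmax_bounds nz formB by (metis basin)

  have part2: "\<mu> < (13 - sqrt 133) / 6 \<longrightarrow> 0 < \<alpha>"
  proof
    \<comment> \<open>The bound is the smaller root of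
      \<open>3 * \<mu>\<^sup>2 - 13 * \<mu> + 3\<close>, that is, of
      \<open>(1 - \<mu>)\<^sup>2 - 7 * \<mu> / 3\<close>; and \<open>\<kappa> \<ge> 1\<close> allows
      replacing \<open>\<mu> / \<kappa>\<close> by \<open>\<mu>\<close>.\<close>
    assume m: "\<mu> < (13 - sqrt 133) / 6"
    have "(sqrt 133)\<^sup>2 < (13 - 6 * \<mu>)\<^sup>2" using m by (intro power_strict_mono) auto
    then have "0 < (1 - \<mu>)\<^sup>2 - 7 * \<mu> / 3" by (simp add: power2_eq_square algebra_simps)
    moreover have "\<mu> / \<kappa> \<le> \<mu>" using mult_right_mono[OF k1 mu(1)] k1 by (simp add: field_simps)
    then have "(1 - \<mu>)\<^sup>2 \<le> (1 - \<mu> / \<kappa>)\<^sup>2" using mu by (intro power_mono) auto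
    ultimately show "0 < \<alpha>" by (simp add: \<alpha>)
  qed

  have part3: "(\<forall>Y\<in>basin \<mu> Ys. hess_lmin h Y \<ge> \<alpha> * \<sigma>r\<^sup>2) \<and> \<alpha> * \<sigma>r\<^sup>2 > 0 \<and>
        geod_strongly_convex_on (cls ` basin \<mu> Ys) h \<and>
        geod_smooth_on (cls ` basin \<mu> Ys) h \<and>
        (\<forall>Yh\<in>basin \<mu> Ys. grad_lift h Yh = 0 \<longrightarrow>
           local_minimizer_on quot_mfd h Yh \<and>
           (\<forall>Z. local_minimizer_on (cls ` basin \<mu> Ys) h Z \<longrightarrow> cls Z = cls Yh) \<and>
           qdist Yh Ys \<le> 2 * norm (egrad f (Ys ** transpose Ys) ** Ys) / (\<alpha> * \<sigma>r\<^sup>2) \<and>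
           2 * norm (egrad f (Ys ** transpose Ys) ** Ys) / (\<alpha> * \<sigma>r\<^sup>2)
             \<le> 2 * spectral_norm Ys * N / (\<alpha> * \<sigma>r\<^sup>2))"
    if al: "0 < \<alpha>" and de: "\<delta> \<le> \<alpha> / (4 * (2 * (\<kappa> + \<mu> / \<kappa>)\<^sup>2 + 7 * \<mu> / 3))"
      and Nle: "N \<le> \<alpha> * \<sigma>r\<^sup>2 / 4"
  proof -
    define m where "m = \<alpha> * \<sigma>r\<^sup>2"
    have m0: "0 < m" using al b0 by (simp add: m_def)
    \<comment> \<open>The main term of \<open>LB\<close> is \<open>2 * m\<close>; the assumption on
      \<open>\<delta>\<close> limits its terms to \<open>m / 2\<close>, and the one on
      \<open>N\<close> limits \<open>2 * N\<close> to \<open>m / 2\<close>.\<close>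
    have mLB: "m \<le> LB"
    proof -
      define T where "T = 2 * (\<kappa> + \<mu> / \<kappa>)\<^sup>2 + 7 * \<mu> / 3"
      have "0 < \<kappa> + \<mu> / \<kappa>" using k1 mu by (intro add_pos_nonneg) auto
      then have T: "0 < T" using mu by (simp add: T_def add_pos_nonneg)
      have "\<delta> * (4 * T) \<le> \<alpha>" using de T unfolding T_def[symmetric] by (simp add: pos_le_divide_eq)
      then have "\<delta> * (4 * T) * \<sigma>r\<^sup>2 \<le> m" unfolding m_def by (rule mult_right_mono) simp
      moreover have "\<sigma>1 + \<rho> = \<sigma>r * (\<kappa> + \<mu> / \<kappa>)" using b0 by (simp add: \<rho>_def k algebra_simps)
      then have "(\<sigma>1 + \<rho>)\<^sup>2 = \<sigma>r\<^sup>2 * (\<kappa> + \<mu> / \<kappa>)\<^sup>2" by (simp add: power_mult_distrib)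
      then have "4 * \<delta> * (\<sigma>1 + \<rho>)\<^sup>2 + 14 / 3 * \<delta> * \<mu> * \<sigma>r\<^sup>2 = \<delta> * (4 * T) * \<sigma>r\<^sup>2 / 2"
        by (simp add: T_def algebra_simps)
      moreover have "(2 * (1 - \<mu> / \<kappa>)\<^sup>2 - 14 / 3 * \<mu>) * \<sigma>r\<^sup>2 = 2 * m"
        by (simp add: m_def \<alpha> algebra_simps)
      ultimately show ?thesis using Nle[folded m_def] unfolding LB_def by linarith
    qed
    have strong: "m * (norm \<theta>)\<^sup>2 \<le> hess_form h Y \<theta>" if "qdist Y Ys \<le> \<rho>" "\<theta> \<in> horizontal Y" for Y \<theta>
      using formB(1)[OF that] mult_right_mono[OF mLB, of "(norm \<theta>)\<^sup>2"] by simp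

    \<comment> \<open>Inside the ball the smallest singular value stays above
      \<open>\<sigma>r - \<rho> > 0\<close>, so membership in the basin reduces to a distance
      bound.\<close>
    have fr: "Y \<in> full_rank" if Y: "qdist Y Ys \<le> \<rho>" for Y
    proof -
      obtain Q where Q: "orthogonal_matrix Q" "qdist Y Ys = norm (Ys ** Q - Y)"
        by (rule qdist_attained)
      have YZ: "norm (Y - Ys ** Q) \<le> \<rho>" using Q(2) Y by (simp add: norm_minus_commute)
      show ?thesis
        using bounds_perturb(2)[OF YZ bounds_mult_orthogonal(2)[OF Q(1) lower]] rho3 b0
        by (intro full_rankI[of "\<sigma>r - \<rho>"]) auto
    qed
    have basin': "Y \<in> basin \<mu> Ys \<longleftrightarrow> qdist Y Ys \<le> \<rho>" for Y using fr basin by blast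
    have in_basin: "qdist Y Ys \<le> \<rho>" if Y: "cls Y \<in> cls ` basin \<mu> Ys" for Y
    proof -
      obtain Z where Z: "cls Y = cls Z" "qdist Z Ys \<le> \<rho>" using Y basin' by blast
      from Z(1) obtain Q where "orthogonal_matrix Q" "Y = Z ** Q" by (rule cls_eqE)
      then show ?thesis using Z(2) by (simp add: qdist_mult_left)
    qed

    have join: "\<exists>W. cls W = cls Y2 \<and> W - Y1 \<in> horizontal Y1 \<and>
        (\<forall>t\<in>{0..1}. qdist (Y1 + t *\<^sub>R (W - Y1)) Ys \<le> \<rho>)"
      if Y: "qdist Y1 Ys \<le> \<rho>" "qdist Y2 Ys \<le> \<rho>" for Y1 Y2
    proof -
      obtain Q where Q: "orthogonal_matrix Q" "qdist Y1 Y2 = norm (Y2 ** Q - Y1)"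
        "transpose (transpose (Y2 ** Q) ** Y1) = transpose (Y2 ** Q) ** Y1"
        by (rule qdist_aligned)
      define W where "W = Y2 ** Q"
      have hor: "W - Y1 \<in> horizontal Y1" unfolding W_def by (rule horizontal_diff[OF Q(3)])
      have W: "qdist W Ys \<le> \<rho>" using Y(2) by (simp add: W_def qdist_mult_left[OF Q(1)])
      have "qdist Y1 Y2 \<le> 2 * \<rho>" using qdist_triangle[of Y1 Y2 Ys] Y by simp
      then have len: "norm (W - Y1) \<le> 2 * \<rho>" using Q(2) by (simp add: W_def)
      have "qdist (Y1 + t *\<^sub>R (W - Y1)) Ys \<le> \<rho>" if "t \<in> {0..1}" for t
        by (rule qdist_ball_geodesic[OF upper lower b0 a0 rho3 arho3 Y(1) W hor len that])
      then show ?thesis using hor Q(2) by (intro exI[of _ W]) (auto simp: W_def cls_mult[OF Q(1)])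
    qed

    have convex: "geod_convex (cls ` basin \<mu> Ys)"
      unfolding geod_convex_def
    proof (intro conjI ballI)
      show "cls ` basin \<mu> Ys \<subseteq> quot_mfd" unfolding quot_mfd_def using basin by auto
      fix P P' assume "P \<in> cls ` basin \<mu> Ys" "P' \<in> cls ` basin \<mu> Ys"
      then obtain Y1 Y2 where Y: "P = cls Y1" "P' = cls Y2" "qdist Y1 Ys \<le> \<rho>" "qdist Y2 Ys \<le> \<rho>"
        using basin by auto
      from join[OF Y(3,4)] obtain W where W: "cls W = cls Y2" "W - Y1 \<in> horizontal Y1"
        "\<And>t. t \<in> {0..1} \<Longrightarrow> qdist (Y1 + t *\<^sub>R (W - Y1)) Ys \<le> \<rho>" by blast
      have "geodesic (\<lambda>t. cls (Y1 + t *\<^sub>R (W - Y1)))"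
        by (rule geodesic_line[OF W(2)]) (rule fr[OF W(3)])
      then show "\<exists>\<gamma>. geodesic \<gamma> \<and> \<gamma> 0 = P \<and> \<gamma> 1 = P' \<and> \<gamma> ` {0..1} \<subseteq> cls ` basin \<mu> Ys"
        using W basin' by (intro exI[of _ "\<lambda>t. cls (Y1 + t *\<^sub>R (W - Y1))"]) (auto simp: Y)
    qed
    have sconvex: "geod_strongly_convex_on (cls ` basin \<mu> Ys) h"
      unfolding geod_strongly_convex_on_def using convex m0 strong in_basin by blast
    have smooth: "geod_smooth_on (cls ` basin \<mu> Ys) h"
      unfolding geod_smooth_on_def using formB(2) in_basin by blast
    have lmin: "\<forall>Y\<in>basin \<mu> Ys. hess_lmin h Y \<ge> m"
      using part1 mLB by force

    have stationary: "local_minimizer_on quot_mfd h Yh \<and>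
           (\<forall>Z. local_minimizer_on (cls ` basin \<mu> Ys) h Z \<longrightarrow> cls Z = cls Yh) \<and>
           qdist Yh Ys \<le> 2 * norm (egrad f (Ys ** transpose Ys) ** Ys) / m"
      if Yh: "qdist Yh Ys \<le> \<rho>" and stat: "grad_lift h Yh = 0" for Yh
    proof (intro conjI allI impI)
      show "local_minimizer_on quot_mfd h Yh"
      proof -
        \<comment> \<open>\<open>Yh\<close> may lie on the boundary of the ball. Positivity of
          \<open>lo\<close> persists for radii slightly above \<open>\<rho>\<close>, which makes the
          Hessian nonnegative on a full neighbourhood of \<open>Yh\<close>.\<close>
        have "isCont lo \<rho>" unfolding lo_def by (intro continuous_intros)
        moreover have "0 < lo \<rho>" using m0 mLB LB by linarith
        ultimately have "\<forall>\<^sub>F x in at \<rho>. 0 < lo x" unfolding isCont_def by (rule order_tendstoD(1))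
        then obtain e where e: "0 < e" "\<And>x. x \<noteq> \<rho> \<Longrightarrow> dist x \<rho> < e \<Longrightarrow> 0 < lo x"
          unfolding eventually_at by blast
        \<comment> \<open>Halving \<open>e\<close> gives the strict inequality, and the second bound
          keeps the enlarged radius within the range of \<open>form\<close>.\<close>
        define \<epsilon> where "\<epsilon> = min (e / 2) (\<sigma>r - \<rho>)"
        have eps: "0 < \<epsilon>" "\<epsilon> < e" "\<rho> + \<epsilon> \<le> \<sigma>r" using e b0 rho3 by (auto simp: \<epsilon>_def)
        have lo0: "0 < lo (\<rho> + \<epsilon>)" by (rule e(2)) (use eps in \<open>auto simp: dist_real_def\<close>)
        have psd: "0 \<le> hess_form h W \<theta>" if W: "norm (W - Yh) < \<epsilon>" "\<theta> \<in> horizontal W" for W \<theta>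
        proof -
          have "qdist W Ys \<le> \<rho> + \<epsilon>" using qdist_triangle_norm[of W Ys Yh] Yh W(1) by linarith
          from form[OF this eps(3) W(2)] have "lo (\<rho> + \<epsilon>) * (norm \<theta>)\<^sup>2 \<le> hess_form h W \<theta>" by blast
          moreover have "0 \<le> lo (\<rho> + \<epsilon>) * (norm \<theta>)\<^sup>2" using lo0 by simp
          ultimately show ?thesis by linarith
        qed
        have "h (cls Yh) \<le> h (cls Z)" if "qdist Yh Z < \<epsilon>" for Z
          unfolding h by (rule stationary_le_near[OF f_C2 f_sym stat[unfolded h] psd[unfolded h] that])
        moreover have "cls Yh \<in> quot_mfd" unfolding quot_mfd_def using fr[OF Yh] by blast
        ultimately show ?thesis unfolding local_minimizer_on_def using eps(1) by blast
      qed
      fix Z assume Zmin: "local_minimizer_on (cls ` basin \<mu> Ys) h Z"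
      then have Z: "qdist Z Ys \<le> \<rho>" using in_basin by (simp add: local_minimizer_on_def)
      obtain e where e: "0 < e"
        and min: "\<And>V. cls V \<in> cls ` basin \<mu> Ys \<Longrightarrow> qdist Z V < e \<Longrightarrow> h (cls Z) \<le> h (cls V)"
        using Zmin unfolding local_minimizer_on_def by blast
      from join[OF Yh Z] obtain W where W: "cls W = cls Z" "W - Yh \<in> horizontal Yh"
        "\<And>t. t \<in> {0..1} \<Longrightarrow> qdist (Yh + t *\<^sub>R (W - Yh)) Ys \<le> \<rho>" by blast
      show "cls Z = cls Yh"
      proof (rule ccontr)
        assume "cls Z \<noteq> cls Yh"
        define \<theta> where "\<theta> = W - Yh"
        have th: "0 < norm \<theta>" using \<open>cls Z \<noteq> cls Yh\<close> W(1) by (auto simp: \<theta>_def)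
        \<comment> \<open>A point just before the end of the segment, within \<open>e\<close> of
          \<open>[Z]\<close>. Strong convexity makes \<open>h\<close> strictly increase from there
          to \<open>[Z]\<close>, against the local minimality of \<open>[Z]\<close>.\<close>
        define t where "t = max 0 (1 - e / (2 * norm \<theta>))"
        have t: "0 \<le> t" "t < 1" using e th by (auto simp: t_def)
        have "(1 - t) * norm \<theta> \<le> e / (2 * norm \<theta>) * norm \<theta>"
          using th by (intro mult_right_mono) (auto simp: t_def)
        then have close: "(1 - t) * norm \<theta> < e" using e th by simp
        obtain Q where Q: "orthogonal_matrix Q" "W = Z ** Q" using W(1) by (rule cls_eqE)
        have "W - (Yh + t *\<^sub>R \<theta>) = (1 - t) *\<^sub>R \<theta>" by (simp add: \<theta>_def algebra_simps)
        then have "qdist Z (Yh + t *\<^sub>R \<theta>) < e"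
          using qdist_mult_commute_le[OF Q(1), of Z "Yh + t *\<^sub>R \<theta>"] close t
          by (simp add: Q(2)[symmetric] norm_minus_commute[of _ W])
        moreover have "cls (Yh + t *\<^sub>R \<theta>) \<in> cls ` basin \<mu> Ys"
          using W(3)[of t] t basin' by (auto simp: \<theta>_def)
        ultimately have le: "h (cls Z) \<le> h (cls (Yh + t *\<^sub>R \<theta>))" using min by blast
        obtain u where u: "t < u" "u < 1" "h (cls (Yh + 1 *\<^sub>R \<theta>)) - h (cls (Yh + t *\<^sub>R \<theta>))
            = (1 - t) * (grad_lift h (Yh + u *\<^sub>R \<theta>) \<bullet> \<theta>)"
          using quot_fun_line_less[OF d t(2), of Yh \<theta>] unfolding h by blast
        have hor: "\<theta> \<in> horizontal Yh" using W(2) by (simp add: \<theta>_def)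
        have "m * (norm \<theta>)\<^sup>2 \<le> hess_form h (Yh + s *\<^sub>R \<theta>) \<theta>" if "s \<in> {0..1}" for s
          using W(3)[OF that] by (intro strong horizontal_line[OF hor]) (simp add: \<theta>_def)
        from grad_lift_line_ge[OF f_C2 f_sym hor this[unfolded h], of u]
        have "u * (m * (norm \<theta>)\<^sup>2) \<le> grad_lift h (Yh + u *\<^sub>R \<theta>) \<bullet> \<theta>"
          using u t stat by (simp add: h)
        moreover have "0 < u * (m * (norm \<theta>)\<^sup>2)" using u t m0 th by simp
        ultimately have "0 < (1 - t) * (grad_lift h (Yh + u *\<^sub>R \<theta>) \<bullet> \<theta>)" using t by simp
        then have "h (cls (Yh + t *\<^sub>R \<theta>)) < h (cls W)" using u(3) by (simp add: \<theta>_def)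
        then show False using le W(1) by simp
      qed
    next
      show "qdist Yh Ys \<le> 2 * norm (egrad f (Ys ** transpose Ys) ** Ys) / m"
      proof -
        obtain Q where Q: "orthogonal_matrix Q" "qdist Yh Ys = norm (Ys ** Q - Yh)"
          "transpose (transpose (Ys ** Q) ** Yh) = transpose (Ys ** Q) ** Yh"
          by (rule qdist_aligned)
        define \<theta> where "\<theta> = Ys ** Q - Yh"
        have hor: "\<theta> \<in> horizontal Yh" unfolding \<theta>_def by (rule horizontal_diff[OF Q(3)])
        have "m * (norm \<theta>)\<^sup>2 \<le> hess_form h (Yh + s *\<^sub>R \<theta>) \<theta>" if s: "s \<in> {0..1}" for s
        proof (rule strong[OF _ horizontal_line[OF hor]])
          \<comment> \<open>This segment runs to the centre of the ball, so the distance bound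
            follows directly from the given rotation \<open>Q\<close>.\<close>
          have "Ys ** Q - (Yh + s *\<^sub>R \<theta>) = (1 - s) *\<^sub>R \<theta>" by (simp add: \<theta>_def algebra_simps)
          then have "qdist (Yh + s *\<^sub>R \<theta>) Ys \<le> (1 - s) * norm \<theta>"
            using qdist_le[OF Q(1), of "Yh + s *\<^sub>R \<theta>" Ys] s by simp
          also have "\<dots> \<le> norm \<theta>" using s by (intro mult_left_le_one_le) auto
          finally show "qdist (Yh + s *\<^sub>R \<theta>) Ys \<le> \<rho>" using Yh Q(2) by (simp add: \<theta>_def)
        qed
        \<comment> \<open>The gradient vanishes at \<open>Yh\<close>, so all growth of the
          derivative is visible at the other end, where the gradient is that of the target up to
          rotation.\<close>
        from grad_lift_line_ge[OF f_C2 f_sym hor this[unfolded h], of 1]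
        have "m * (norm \<theta>)\<^sup>2 \<le> grad_lift h (Ys ** Q) \<bullet> \<theta>"
          using stat by (simp add: h \<theta>_def)
        also have "\<dots> \<le> norm (grad_lift h (Ys ** Q)) * norm \<theta>" by (rule norm_cauchy_schwarz)
        also have "grad_lift h (Ys ** Q) = 2 *\<^sub>R (egrad f (Ys ** transpose Ys) ** Ys ** Q)"
          by (simp only: h grad_lift_quot_fun[OF d f_sym] gram_mult_orthogonal[OF Q(1)] matrix_mul_assoc)
        finally have "m * (norm \<theta>)\<^sup>2 \<le> 2 * norm (egrad f (Ys ** transpose Ys) ** Ys) * norm \<theta>"
          by (simp add: norm_mult_orthogonal[OF Q(1)])
        then have "m * norm \<theta> \<le> 2 * norm (egrad f (Ys ** transpose Ys) ** Ys)"
          by (cases "\<theta> = 0") (simp_all add: power2_eq_square mult.assoc[symmetric])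
        then show ?thesis using m0 Q(2) by (simp add: \<theta>_def field_simps)
      qed
    qed
    have "norm (egrad f (Ys ** transpose Ys) ** Ys) \<le> spectral_norm Ys * N"
      unfolding fac(3) N by (rule norm_grad_mult_le[OF G])
    then have "2 * norm (egrad f (Ys ** transpose Ys) ** Ys) / m \<le> 2 * spectral_norm Ys * N / m"
      using m0 by (simp add: divide_right_mono)
    then show ?thesis
      using lmin m0 sconvex smooth stationary basin' unfolding m_def by blast
  qed
  show ?thesis
    using part1 part2 part3 unfolding LB_def UB_def \<rho>_def by blast
qed

end
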